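(* Let $G$ be a group with a finite generating set $A$ closed under inversion, and suppose that the pair $(G,A)$ has the falsification by fellow traveler property. Then: (a) $G$ admits a length non-increasing end-normal synchronously regular convergent prefix-rewriting system over the alphabet $A$; and (b) $G$ is geodesically autostackable (with respect to $A$).
   Context: **Basic notation.** $A^*$ is the set of words over $A$; $|u|$ is the length of $u$; $u(n)$ is the prefix of $u$ of length $n$ (and $u(n)=u$ if $n\ge|u|$); $\mathrm{last}(u)$ is the last letter of $u$; $u=_Gv$ means $u$ and $v$ represent the same element of $G$. Each $a\in A$ has an inverse letter $a^{-1}\in A$. $\Gamma_{G,A}$ is the Cayley graph, with a directed edge $e_{y,a}$ from $y$ to $ya$ labeled $a$ for each $y\in G,a\in A$; $e_{y,a}$ and $e_{ya,a^{-1}}$ have the same underlying undirected edge; $\iota(e),\tau(e)$ are the initial and terminal vertices of $e$, and $d_{G,A}$ is the path metric. **FFTP.** $(G,A)$ has the falsification by fellow traveler property if there is a constant $k$ such that for each non-geodesic word $u\in A^*$ there is a word $v\in A^*$ with $|v|<|u|$, $u=_Gv$, and $u$ and $v$ $k$-fellow travel, i.e. $d_{G,A}(u(n),v(n))\le k$ for all $n\in\mathbb{N}$ (words being identified with the group elements they represent). **Synchronous regularity.** Given $L\subseteq A_1^*\times\cdots\times A_n^*$ and padding symbols $\$_i\notin A_i$, each tuple in $L$ is padded by appending symbols $\$_i$ at the end of the $i$th component until all components have the same length as the longest one; the result is a word over $\prod_i(A_i\cup\{\$_i\})$. $L$ is synchronously regular if the set of padded tuples is a regular language. **Prefix-rewriting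 systems.** A convergent prefix-rewriting system for $G$ over $A$ is a set $R\subseteq A^*\times A^*$ such that $G$ is presented as a monoid by $\mathrm{Mon}\langle A\mid\{u=v:(u,v)\in R\}\rangle$, and the rewritings $uw\to_R vw$ ($(u,v)\in R$, $w\in A^*$) satisfy: there is no infinite chain $w_1\to_R w_2\to_R\cdots$, and each element of $G$ is represented by exactly one irreducible word (a word that cannot be rewritten). $\mathrm{nf}_R(u)$ is the irreducible word with $\mathrm{nf}_R(u)=_Gu$. $R$ is length non-increasing if $|v|\le|u|$ for all $(u,v)\in R$; it is end-normal if for every $(u,v)\in R$ with $u=wl$, $w$ irreducible and $l\in A$, we have $\mathrm{last}(v)=\mathrm{last}(\mathrm{nf}_R(v))$ (read as: $v$ and $\mathrm{nf}_R(v)$ are either both empty or both nonempty with the same last letter). **Geodesic autostackability.** Given a spanning tree $T$ of $\Gamma_{G,A}$, $\mathrm{nf}(g)$ is the label of the unique non-backtracking path in $T$ from $1_G$ to $g$. A regular bounded flow function for $(G,A,T)$ is a function $\Phi$ from directed edges to directed paths of $\Gamma_{G,A}$ such that: (1) $\Phi(e)$ has the same initial and terminal vertices as $e$; (2) the lengths of the paths $\Phi(e)$ are uniformly bounded; (3) $\Phi(e)=e$ if the undirected edge underlying $e$ lies in $T$; (4) there is no infinite sequence $e_1,e_2,\dots$ of edges outside $T$ with $e_{i+1}$ in the path $\Phi(e_i)$ for all $i$; (5) the set of triples $(\mathrm{nf}(\iota(e)),\mathrm{label}(e),\mathrm{label}(\Phi(e)))$ is synchronously regular. Let $\alpha(e)=\tfrac12\big(d_{G,A}(1_G,\iota(e))+d_{G,A}(1_G,\tau(e))\big)$.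 $G$ is geodesically autostackable (with respect to $A$) if there are a spanning tree $T$ and a regular bounded flow function $\Phi$ for $(G,A,T)$ such that each $\mathrm{nf}(g)$, $g\in G$, labels a geodesic in $\Gamma_{G,A}$ and, whenever $e,e'$ are directed edges with $\Phi(e')\neq e'$ and $e'$ an edge in the path $\Phi(e)$, we have $\alpha(e')<\alpha(e)$. *)

theory Defs
  imports
    Complex_Main
    "HOL-Algebra.Generated_Groups"
    "Graph_Theory.Digraph_Component"
begin

section \<open>Regular and synchronously regular languages\<close>

text \<open>
  A language over a finite alphabet is regular if it is accepted by a deterministic finite
  automaton. Taking the states to be natural numbers is no restriction.
\<close>

definition regular_language :: "'c set \<Rightarrow> 'c list set \<Rightarrow> bool" where
  "regular_language \<Sigma> L \<longleftrightarrow> finite \<Sigma> \<and>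
    (\<exists>(Q :: nat set) q\<^sub>0 F (\<delta> :: nat \<Rightarrow> 'c \<Rightarrow> nat).
       finite Q \<and> q\<^sub>0 \<in> Q \<and> F \<subseteq> Q \<and> (\<forall>q\<in>Q. \<forall>c\<in>\<Sigma>. \<delta> q c \<in> Q) \<and>
       L = {w \<in> lists \<Sigma>. foldl \<delta> q\<^sub>0 w \<in> F})"

text \<open>
  An \<open>n\<close>-tuple of words is a list of \<open>n\<close> words, a letter of the padded word is a list of
  \<open>n\<close> symbols, and \<^const>\<open>None\<close> is the padding symbol of each component.
\<close>

definition pad_tuple :: "'a list list \<Rightarrow> 'a option list list" where
  "pad_tuple ws =
     map (\<lambda>j. map (\<lambda>w. if j < length w then Some (w ! j) else None) ws)
       [0..<foldr max (map length ws) 0]"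

definition sync_regular :: "'a set list \<Rightarrow> 'a list list set \<Rightarrow> bool" where
  "sync_regular As L \<longleftrightarrow>
     L \<subseteq> listset (map lists As) \<and>
     regular_language (listset (map (\<lambda>A. insert None (Some ` A)) As)) (pad_tuple ` L)"


section \<open>Words and the Cayley graph\<close>

definition word_val :: "('a, 'm) monoid_scheme \<Rightarrow> 'a list \<Rightarrow> 'a" where
  "word_val G w = foldr (\<otimes>\<^bsub>G\<^esub>) w \<one>\<^bsub>G\<^esub>"

text \<open>The pair \<open>(y, a)\<close> is the directed edge labeled \<open>a\<close> from \<open>y\<close> to \<open>ya\<close>.\<close>

definition cayley_graph :: "('a, 'm) monoid_scheme \<Rightarrow> 'a set \<Rightarrow> ('a, 'a \<times> 'a) pre_digraph" where
  "cayley_graph G A =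
     \<lparr>verts = carrier G, arcs = carrier G \<times> A, tail = fst, head = (\<lambda>(y, a). y \<otimes>\<^bsub>G\<^esub> a)\<rparr>"

abbreviation cayley_path ::
    "('a, 'm) monoid_scheme \<Rightarrow> 'a set \<Rightarrow> 'a \<Rightarrow> ('a \<times> 'a) list \<Rightarrow> 'a \<Rightarrow> bool" where
  "cayley_path G A \<equiv> pre_digraph.awalk (cayley_graph G A)"

definition path_label :: "('a \<times> 'a) list \<Rightarrow> 'a list" where
  "path_label p = map snd p"

text \<open>The same undirected edge, traversed in the opposite direction.\<close>

definition edge_inv :: "('a, 'm) monoid_scheme \<Rightarrow> 'a \<times> 'a \<Rightarrow> 'a \<times> 'a" where
  "edge_inv G e = (fst e \<otimes>\<^bsub>G\<^esub> snd e, inv\<^bsub>G\<^esub> (snd e))"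

definition non_backtracking :: "('a, 'm) monoid_scheme \<Rightarrow> ('a \<times> 'a) list \<Rightarrow> bool" where
  "non_backtracking G p \<longleftrightarrow> successively (\<lambda>e e'. e' \<noteq> edge_inv G e) p"

text \<open>
  When \<open>A\<close> is closed under inversion, directed and undirected paths give the same path metric.
\<close>

definition cayley_dist :: "('a, 'm) monoid_scheme \<Rightarrow> 'a set \<Rightarrow> 'a \<Rightarrow> 'a \<Rightarrow> nat" where
  "cayley_dist G A x y = (LEAST n. \<exists>p. cayley_path G A x p y \<and> length p = n)"

definition geodesic_word :: "('a, 'm) monoid_scheme \<Rightarrow> 'a set \<Rightarrow> 'a list \<Rightarrow> bool" where
  "geodesic_word G A w \<longleftrightarrow>
     w \<in> lists A \<and> length w = cayley_dist G A \<one>\<^bsub>G\<^esub> (word_val G w)"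


section \<open>Falsification by fellow traveler\<close>

definition fellow_travel ::
    "('a, 'm) monoid_scheme \<Rightarrow> 'a set \<Rightarrow> nat \<Rightarrow> 'a list \<Rightarrow> 'a list \<Rightarrow> bool" where
  "fellow_travel G A k u v \<longleftrightarrow>
     (\<forall>n. cayley_dist G A (word_val G (take n u)) (word_val G (take n v)) \<le> k)"

definition FFTP :: "('a, 'm) monoid_scheme \<Rightarrow> 'a set \<Rightarrow> bool" where
  "FFTP G A \<longleftrightarrow>
     (\<exists>k. \<forall>u\<in>lists A. \<not> geodesic_word G A u \<longrightarrow>
        (\<exists>v\<in>lists A. length v < length u \<and> word_val G u = word_val G v \<and>
                     fellow_travel G A k u v))"


section \<open>Prefix-rewriting systems\<close>

definition prefix_rewrite :: "'a set \<Rightarrow> ('a list \<times> 'a list) set \<Rightarrow> ('a list \<times> 'a list) set" where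
  "prefix_rewrite A R = {(u @ w, v @ w) | u v w. (u, v) \<in> R \<and> w \<in> lists A}"

definition irreducible_word :: "'a set \<Rightarrow> ('a list \<times> 'a list) set \<Rightarrow> 'a list \<Rightarrow> bool" where
  "irreducible_word A R w \<longleftrightarrow> w \<in> lists A \<and> (\<nexists>w'. (w, w') \<in> prefix_rewrite A R)"

text \<open>
  \<open>G\<close> is presented as a monoid by the generators \<open>A\<close> and the relations \<open>u = v\<close> for \<open>(u, v) \<in> R\<close>
  if evaluation of words is a surjection onto \<open>G\<close> whose kernel is the two-sided congruence on
  words generated by \<open>R\<close>.
\<close>

definition relation_step :: "'a set \<Rightarrow> ('a list \<times> 'a list) set \<Rightarrow> ('a list \<times> 'a list) set" where
  "relation_step A R =
     {(x @ u @ y, x @ v @ y) | x u v y. (u, v) \<in> R \<and> x \<in> lists A \<and> y \<in> lists A}"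

definition monoid_presents ::
    "('a, 'm) monoid_scheme \<Rightarrow> 'a set \<Rightarrow> ('a list \<times> 'a list) set \<Rightarrow> bool" where
  "monoid_presents G A R \<longleftrightarrow>
     word_val G ` lists A = carrier G \<and>
     (\<forall>u\<in>lists A. \<forall>v\<in>lists A.
        word_val G u = word_val G v \<longleftrightarrow> (u, v) \<in> (relation_step A R \<union> (relation_step A R)\<inverse>)\<^sup>*)"

definition convergent_prs ::
    "('a, 'm) monoid_scheme \<Rightarrow> 'a set \<Rightarrow> ('a list \<times> 'a list) set \<Rightarrow> bool" where
  "convergent_prs G A R \<longleftrightarrow>
     R \<subseteq> lists A \<times> lists A \<and>
     monoid_presents G A R \<and>
     (\<nexists>s :: nat \<Rightarrow> 'a list. \<forall>i. (s i, s (Suc i)) \<in> prefix_rewrite A R) \<and>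
     (\<forall>g\<in>carrier G. \<exists>!w. irreducible_word A R w \<and> word_val G w = g)"

definition prs_nf ::
    "('a, 'm) monoid_scheme \<Rightarrow> 'a set \<Rightarrow> ('a list \<times> 'a list) set \<Rightarrow> 'a list \<Rightarrow> 'a list" where
  "prs_nf G A R u = (THE w. irreducible_word A R w \<and> word_val G w = word_val G u)"

definition length_nonincreasing :: "('a list \<times> 'a list) set \<Rightarrow> bool" where
  "length_nonincreasing R \<longleftrightarrow> (\<forall>(u, v)\<in>R. length v \<le> length u)"

definition end_normal ::
    "('a, 'm) monoid_scheme \<Rightarrow> 'a set \<Rightarrow> ('a list \<times> 'a list) set \<Rightarrow> bool" where
  "end_normal G A R \<longleftrightarrow>
     (\<forall>w l v. (w @ [l], v) \<in> R \<and> irreducible_word A R w \<and> l \<in> A \<longrightarrow>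
        (v = [] \<longleftrightarrow> prs_nf G A R v = []) \<and>
        (v \<noteq> [] \<longrightarrow> last v = last (prs_nf G A R v)))"

definition sync_regular_prs :: "'a set \<Rightarrow> ('a list \<times> 'a list) set \<Rightarrow> bool" where
  "sync_regular_prs A R \<longleftrightarrow> sync_regular [A, A] {[u, v] | u v. (u, v) \<in> R}"


section \<open>Geodesic autostackability\<close>

text \<open>
  A subgraph of the undirected Cayley graph is given by the set of all directed versions of its
  edges, hence closure under \<^const>\<open>edge_inv\<close>. The predicates \<^const>\<open>forest\<close> and
  \<^const>\<open>tree\<close> from the library do not apply: they exclude directed cycles only, and an edge
  followed by its inverse would be such a cycle. A tree has no nonempty closed path without
  backtracking.
\<close>

definition cayley_spanning_tree ::
    "('a, 'm) monoid_scheme \<Rightarrow> 'a set \<Rightarrow> ('a, 'a \<times> 'a) pre_digraph \<Rightarrow> bool" where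
  "cayley_spanning_tree G A T \<longleftrightarrow>
     spanning T (cayley_graph G A) \<and>
     (\<forall>e\<in>arcs T. edge_inv G e \<in> arcs T) \<and>
     strongly_connected T \<and>
     (\<nexists>x p. p \<noteq> [] \<and> pre_digraph.awalk T x p x \<and> non_backtracking G p)"

definition tree_nf ::
    "('a, 'm) monoid_scheme \<Rightarrow> ('a, 'a \<times> 'a) pre_digraph \<Rightarrow> 'a \<Rightarrow> 'a list" where
  "tree_nf G T g =
     path_label (THE p. pre_digraph.awalk T \<one>\<^bsub>G\<^esub> p g \<and> non_backtracking G p)"

definition regular_bounded_flow ::
    "('a, 'm) monoid_scheme \<Rightarrow> 'a set \<Rightarrow> ('a, 'a \<times> 'a) pre_digraph
      \<Rightarrow> ('a \<times> 'a \<Rightarrow> ('a \<times> 'a) list) \<Rightarrow> bool" where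
  "regular_bounded_flow G A T \<Phi> \<longleftrightarrow>
     (let \<Gamma> = cayley_graph G A in
      (\<forall>e\<in>arcs \<Gamma>. cayley_path G A (tail \<Gamma> e) (\<Phi> e) (head \<Gamma> e)) \<and>
      (\<exists>K. \<forall>e\<in>arcs \<Gamma>. length (\<Phi> e) \<le> K) \<and>
      (\<forall>e\<in>arcs T. \<Phi> e = [e]) \<and>
      (\<nexists>s :: nat \<Rightarrow> 'a \<times> 'a.
         \<forall>i. s i \<in> arcs \<Gamma> - arcs T \<and> s (Suc i) \<in> set (\<Phi> (s i))) \<and>
      sync_regular [A, A, A]
        {[tree_nf G T (tail \<Gamma> e), [snd e], path_label (\<Phi> e)] | e. e \<in> arcs \<Gamma>})"

definition edge_height :: "('a, 'm) monoid_scheme \<Rightarrow> 'a set \<Rightarrow> 'a \<times> 'a \<Rightarrow> real" where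
  "edge_height G A e =
     (real (cayley_dist G A \<one>\<^bsub>G\<^esub> (tail (cayley_graph G A) e)) +
      real (cayley_dist G A \<one>\<^bsub>G\<^esub> (head (cayley_graph G A) e))) / 2"

definition geodesically_autostackable :: "('a, 'm) monoid_scheme \<Rightarrow> 'a set \<Rightarrow> bool" where
  "geodesically_autostackable G A \<longleftrightarrow>
     (\<exists>T \<Phi>. cayley_spanning_tree G A T \<and> regular_bounded_flow G A T \<Phi> \<and>
        (\<forall>g\<in>carrier G. geodesic_word G A (tree_nf G T g)) \<and>
        (\<forall>e\<in>arcs (cayley_graph G A). \<forall>e'\<in>arcs (cayley_graph G A).
           \<Phi> e' \<noteq> [e'] \<and> e' \<in> set (\<Phi> e) \<longrightarrow> edge_height G A e' < edge_height G A e))"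

end

theory Submission
  imports Defs
begin

text \<open>
  Iterating the falsification property \<open>J\<close> times shows that the excess over a geodesic of a
  path leaving \<open>g\<close>, capped at \<open>J\<close>, depends only on the relative word lengths in a ball
  around \<open>g\<close>. Hence there are finitely many capped excess functions, and they are updated
  letter by letter along geodesics. Choosing at every \<open>g\<close> one letter \<open>a\<close> with
  \<open>g a\<^sup>-\<^sup>1\<close> closer to the identity therefore gives a regular, prefix-closed set of geodesic
  normal forms, spanning a tree. For \<open>y\<close> in the group and a letter \<open>a\<close> there is a
  geodesic \<open>v\<close> representing \<open>y a\<close> which ends in the letter chosen at \<open>y a\<close> and fellow
  travels \<open>nf y\<close> followed by \<open>a\<close>.

  The rewriting rules are all pairs of such fellow traveling words. They terminate: in words of
  the same length, a rule corrects the letter at its last position and changes the status only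
  of earlier positions, so the binary number with ones at the wrong letters decreases.
  The flow replaces an edge outside the tree by a path descending along \<open>nf y\<close>, crossing
  to \<open>v\<close> well inside the ball, and ascending along \<open>v\<close>. Whether a path qualifies
  is visible from the capped excess function at \<open>y\<close>, so the choice is regular.
\<close>

section \<open>Regular languages from finite right-invariant maps\<close>

text \<open>A Myhill-Nerode right congruence, given by the map that sends a word to its class.
  Products and pullbacks of such maps need no explicit transition functions.\<close>

definition finite_state :: "'c set \<Rightarrow> ('c list \<Rightarrow> 's) \<Rightarrow> bool" where
  "finite_state \<Sigma> \<phi> \<longleftrightarrow> finite (\<phi> ` lists \<Sigma>) \<and>
     (\<forall>u\<in>lists \<Sigma>. \<forall>v\<in>lists \<Sigma>. \<forall>c\<in>\<Sigma>. \<phi> u = \<phi> v \<longrightarrow> \<phi> (u @ [c]) = \<phi> (v @ [c]))"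

lemma finite_stateI:
  assumes "finite (\<phi> ` lists \<Sigma>)"
    and "\<And>u v c. u \<in> lists \<Sigma> \<Longrightarrow> v \<in> lists \<Sigma> \<Longrightarrow> c \<in> \<Sigma> \<Longrightarrow> \<phi> u = \<phi> v \<Longrightarrow> \<phi> (u @ [c]) = \<phi> (v @ [c])"
  shows "finite_state \<Sigma> \<phi>"
  using assms unfolding finite_state_def by blast

lemma finite_stateD:
  assumes "finite_state \<Sigma> \<phi>" "u \<in> lists \<Sigma>" "v \<in> lists \<Sigma>" "c \<in> \<Sigma>" "\<phi> u = \<phi> v"
  shows "\<phi> (u @ [c]) = \<phi> (v @ [c])"
  using assms unfolding finite_state_def by blast

lemma finite_state_finite: "finite_state \<Sigma> \<phi> \<Longrightarrow> finite (\<phi> ` lists \<Sigma>)"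
  unfolding finite_state_def by blast

text \<open>The values of \<open>\<phi>\<close> serve as states of an automaton, and by
  \<open>det\<close> the predicate \<open>P\<close> is a union of classes.\<close>

lemma regular_language_finite_state:
  assumes "finite \<Sigma>" "finite_state \<Sigma> \<phi>"
    and det: "\<And>u v. u \<in> lists \<Sigma> \<Longrightarrow> v \<in> lists \<Sigma> \<Longrightarrow> \<phi> u = \<phi> v \<Longrightarrow> P u \<Longrightarrow> P v"
  shows "regular_language \<Sigma> {w \<in> lists \<Sigma>. P w}"
proof -
  \<comment> \<open>States have to be natural numbers, so the finitely many values of
    \<open>\<phi>\<close> are coded injectively.\<close>
  obtain e :: "_ \<Rightarrow> nat" where e: "inj_on e (\<phi> ` lists \<Sigma>)"
    using finite_imp_inj_to_nat_seg[OF finite_state_finite[OF assms(2)]] by blast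
  define h where "h w = e (\<phi> w)" for w
  have h_eq: "\<phi> u = \<phi> v" if "u \<in> lists \<Sigma>" "v \<in> lists \<Sigma>" "h u = h v" for u v
    using inj_onD[OF e] that unfolding h_def by (meson imageI)
  define Q where "Q = h ` lists \<Sigma>"
  define F where "F = h ` {w \<in> lists \<Sigma>. P w}"
  \<comment> \<open>A transition appends the letter to some representative of the state; right
    invariance makes the choice of representative irrelevant.\<close>
  define \<delta> where "\<delta> q c = h ((SOME u. u \<in> lists \<Sigma> \<and> h u = q) @ [c])" for q c
  have \<delta>_h: "\<delta> (h w) c = h (w @ [c])" if "w \<in> lists \<Sigma>" "c \<in> \<Sigma>" for w c
  proof -
    define u where "u = (SOME u. u \<in> lists \<Sigma> \<and> h u = h w)"
    have "u \<in> lists \<Sigma> \<and> h u = h w"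
      unfolding u_def by (rule someI[of _ w]) (use that in auto)
    then have "\<phi> (u @ [c]) = \<phi> (w @ [c])"
      by (intro finite_stateD[OF assms(2)] h_eq) (use that in auto)
    then show ?thesis
      unfolding \<delta>_def u_def[symmetric] by (simp add: h_def)
  qed
  have run: "w \<in> lists \<Sigma> \<Longrightarrow> foldl \<delta> (h []) w = h w" for w
    by (induction w rule: rev_induct) (auto simp: \<delta>_h)
  have "finite Q"
    unfolding Q_def h_def using finite_state_finite[OF assms(2)]
    by (metis finite_imageI image_image)
  moreover have "h [] \<in> Q" "F \<subseteq> Q"
    unfolding Q_def F_def by auto
  moreover have "\<forall>q\<in>Q. \<forall>c\<in>\<Sigma>. \<delta> q c \<in> Q"
  proof (intro ballI)
    fix q c assume "q \<in> Q" "c \<in> \<Sigma>"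
    then obtain w where w: "w \<in> lists \<Sigma>" "q = h w"
      unfolding Q_def by blast
    then have "w @ [c] \<in> lists \<Sigma>" using \<open>c \<in> \<Sigma>\<close> by auto
    then show "\<delta> q c \<in> Q"
      using w \<delta>_h \<open>c \<in> \<Sigma>\<close> unfolding Q_def by auto
  qed
  moreover have "{w \<in> lists \<Sigma>. P w} = {w \<in> lists \<Sigma>. foldl \<delta> (h []) w \<in> F}"
  proof (intro Collect_cong conj_cong refl)
    fix w assume w: "w \<in> lists \<Sigma>"
    show "P w \<longleftrightarrow> foldl \<delta> (h []) w \<in> F"
    proof
      assume "foldl \<delta> (h []) w \<in> F"
      then obtain v where "v \<in> lists \<Sigma>" "P v" "h w = h v"
        unfolding F_def run[OF w] by blast
      then show "P w" using det h_eq w by metis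
    qed (use w in \<open>auto simp: F_def run\<close>)
  qed
  ultimately show ?thesis
    unfolding regular_language_def using \<open>finite \<Sigma>\<close> by blast
qed

text \<open>On \<open>S\<close> the map \<open>g\<close> factors through \<open>f\<close>.\<close>

lemma finite_image_determined:
  assumes "finite (f ` S)" "\<And>x y. x \<in> S \<Longrightarrow> y \<in> S \<Longrightarrow> f x = f y \<Longrightarrow> g x = g y"
  shows "finite (g ` S)"
proof -
  have "g ` S \<subseteq> (\<lambda>t. g (SOME x. x \<in> S \<and> f x = t)) ` f ` S"
  proof
    fix t assume "t \<in> g ` S"
    then obtain x where x: "x \<in> S" "t = g x" by blast
    define z where "z = (SOME z. z \<in> S \<and> f z = f x)"
    have "z \<in> S \<and> f z = f x"
      unfolding z_def by (rule someI[of _ x]) (use x in auto)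
    then have "t = g z" using assms(2) x by metis
    then show "t \<in> (\<lambda>t. g (SOME x. x \<in> S \<and> f x = t)) ` f ` S"
      unfolding z_def using x by blast
  qed
  then show ?thesis
    by (rule finite_subset) (use assms(1) in blast)
qed

lemma finite_state_Pair:
  assumes "finite_state \<Sigma> \<phi>" "finite_state \<Sigma> \<psi>"
  shows "finite_state \<Sigma> (\<lambda>w. (\<phi> w, \<psi> w))"
proof (rule finite_stateI)
  have "(\<lambda>w. (\<phi> w, \<psi> w)) ` lists \<Sigma> \<subseteq> \<phi> ` lists \<Sigma> \<times> \<psi> ` lists \<Sigma>" by auto
  then show "finite ((\<lambda>w. (\<phi> w, \<psi> w)) ` lists \<Sigma>)"
    by (rule finite_subset) (use assms in \<open>auto simp: finite_state_def\<close>)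
next
  fix u v c
  assume "u \<in> lists \<Sigma>" "v \<in> lists \<Sigma>" "c \<in> \<Sigma>" "(\<phi> u, \<psi> u) = (\<phi> v, \<psi> v)"
  then show "(\<phi> (u @ [c]), \<psi> (u @ [c])) = (\<phi> (v @ [c]), \<psi> (v @ [c]))"
    using finite_stateD[OF assms(1), of u v c] finite_stateD[OF assms(2), of u v c] by simp
qed

lemma finite_state_take:
  assumes "finite \<Sigma>"
  shows "finite_state \<Sigma> (take m)"
proof (rule finite_stateI)
  have "take m ` lists \<Sigma> \<subseteq> {w. set w \<subseteq> \<Sigma> \<and> length w \<le> m}"
    by (auto dest: in_set_takeD)
  then show "finite (take m ` lists \<Sigma>)"
    using finite_lists_length_le[OF assms] finite_subset by blast
  fix u v :: "'a list" and c :: 'a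
  assume "take m u = take m v"
  moreover have "take m (w @ [c]) = take m (take m w @ [c])" for w :: "'a list"
    by (cases "length w \<le> m") auto
  ultimately show "take m (u @ [c]) = take m (v @ [c])" by metis
qed

text \<open>Whether a word is the left side of a rule depends on the word without its last letter. A
  reader from left to right therefore remembers the state one letter back and the letter just
  read.\<close>

lemma finite_state_prev:
  assumes "finite \<Sigma>" "finite_state \<Sigma> \<phi>"
  shows "finite_state \<Sigma> (\<lambda>u. (\<phi> u, if u = [] then None else Some (\<phi> (butlast u), last u)))"
proof (rule finite_stateI)
  have "(\<lambda>u. (\<phi> u, if u = [] then None else Some (\<phi> (butlast u), last u))) ` lists \<Sigma>
    \<subseteq> \<phi> ` lists \<Sigma> \<times> insert None (Some ` (\<phi> ` lists \<Sigma> \<times> \<Sigma>))" (is "?A \<subseteq> ?B")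
  proof
    fix t assume "t \<in> ?A"
    then obtain u where u: "u \<in> lists \<Sigma>"
      "t = (\<phi> u, if u = [] then None else Some (\<phi> (butlast u), last u))" by blast
    show "t \<in> ?B"
    proof (cases u rule: rev_cases)
      case (snoc w c)
      then show ?thesis using u by (auto intro!: imageI)
    qed (use u in auto)
  qed
  then show "finite ?A"
    by (rule finite_subset) (use assms in \<open>auto simp: finite_state_def\<close>)
next
  fix u v c
  assume "u \<in> lists \<Sigma>" "v \<in> lists \<Sigma>" "c \<in> \<Sigma>"
    and "(\<phi> u, if u = [] then None else Some (\<phi> (butlast u), last u)) =
      (\<phi> v, if v = [] then None else Some (\<phi> (butlast v), last v))"
  then show "(\<phi> (u @ [c]), if u @ [c] = [] then None else Some (\<phi> (butlast (u @ [c])), last (u @ [c]))) =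
      (\<phi> (v @ [c]), if v @ [c] = [] then None else Some (\<phi> (butlast (v @ [c])), last (v @ [c])))"
    using finite_stateD[OF assms(2), of u v c] by simp
qed

definition last_letter :: "'c list \<Rightarrow> 'c option" where
  "last_letter w = (if w = [] then None else Some (last w))"

lemma last_letter_simps [simp]:
  "last_letter [] = None" "last_letter (w @ [a]) = Some a"
  by (simp_all add: last_letter_def)

lemma last_letter_eq_None [simp]: "last_letter w = None \<longleftrightarrow> w = []"
  by (simp add: last_letter_def)

lemma last_letter_eq_iff: "last_letter u = last_letter v \<longleftrightarrow>
    (u = [] \<longleftrightarrow> v = []) \<and> (u \<noteq> [] \<longrightarrow> last u = last v)"
  by (auto simp: last_letter_def)

lemma finite_state_last_letter:
  assumes "finite \<Sigma>"
  shows "finite_state \<Sigma> last_letter"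
proof (rule finite_stateI)
  have "last_letter ` lists \<Sigma> \<subseteq> insert None (Some ` \<Sigma>)"
    by (auto simp: last_letter_def)
  then show "finite (last_letter ` lists \<Sigma>)"
    by (rule finite_subset) (use assms in auto)
qed auto

lemma finite_state_all_letters: "finite_state \<Sigma> (\<lambda>W. \<forall>c\<in>set W. Q c)"
  by (rule finite_stateI) auto

text \<open>\<open>take\<close> past the end repeats the whole word, so \<open>t\<close> ranges over
  the prefixes, and appending a letter adds just one.\<close>

lemma all_take_snoc: "(\<forall>t. P (take t (w @ [c]))) \<longleftrightarrow> (\<forall>t. P (take t w)) \<and> P (w @ [c])"
proof safe
  fix t assume *: "\<forall>t. P (take t (w @ [c]))"
  show "P (take t w)" using spec[OF *, of "min t (length w)"] by (simp add: min_def split: if_splits)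
  show "P (w @ [c])" using spec[OF *, of "Suc (length w)"] by simp
next
  fix t assume *: "\<forall>t. P (take t w)" "P (w @ [c])"
  then show "P (take t (w @ [c]))" by (cases "t \<le> length w") auto
qed

text \<open>A truncation with fewer than \<open>n\<close> letters has lost nothing. Truncating just
  above a length bound thus identifies the words within the bound.\<close>

lemma take_eq_shortD:
  assumes "length u < n" "take n u = take n v"
  shows "u = v"
proof -
  have "take n u = u" using assms(1) by simp
  then have "length (take n v) < n" using assms by simp
  then show ?thesis using assms by simp
qed

section \<open>Padded tuples of words\<close>

definition track :: "nat \<Rightarrow> 'a option list list \<Rightarrow> 'a list" where
  "track i W = List.map_filter (\<lambda>c. c ! i) W"

text \<open>Together with the column alphabet this characterises padded tuples, see
  \<open>pad_tuple_image\<close>. Both clauses concern single or consecutive columns, so finite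
  memory suffices to check them.\<close>

definition well_padded :: "nat \<Rightarrow> 'a option list list \<Rightarrow> bool" where
  "well_padded n W \<longleftrightarrow> successively (\<lambda>c d. \<forall>i<n. c ! i = None \<longrightarrow> d ! i = None) W \<and>
     (\<forall>c\<in>set W. \<exists>i<n. c ! i \<noteq> None)"

abbreviation columns :: "'a set list \<Rightarrow> 'a option list set" where
  "columns As \<equiv> listset (map (\<lambda>A. insert None (Some ` A)) As)"

lemma listset_iff: "xs \<in> listset Ss \<longleftrightarrow> length xs = length Ss \<and> (\<forall>i<length Ss. xs ! i \<in> Ss ! i)"
proof -
  have "xs \<in> listset Ss \<longleftrightarrow> list_all2 (\<in>) xs Ss"
    by (induction Ss arbitrary: xs) (auto simp: set_Cons_def list_all2_Cons2)
  then show ?thesis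
    by (auto simp: list_all2_conv_all_nth)
qed

lemma finite_columns:
  assumes "\<forall>A\<in>set As. finite A"
  shows "finite (columns As)"
proof -
  have "set_Cons S T = (\<lambda>(x, y). x # y) ` (S \<times> T)" for S :: "'a option set" and T
    by (auto simp: set_Cons_def)
  then show ?thesis using assms by (induction As) auto
qed

lemma track_simps [simp]:
  "track i [] = []"
  "track i (W @ [c]) = track i W @ (case c ! i of None \<Rightarrow> [] | Some x \<Rightarrow> [x])"
  by (auto simp: track_def List.map_filter_def split: option.splits)

lemma track_in_lists:
  assumes "W \<in> lists (columns As)" "i < length As"
  shows "track i W \<in> lists (As ! i)"
  using assms(1)
proof (induction W rule: rev_induct)
  case (snoc c W)
  then have "c ! i \<in> insert None (Some ` (As ! i))"
    using assms(2) by (auto simp: listset_iff)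
  with snoc show ?case by (auto split: option.splits)
qed simp

lemma well_padded_snoc:
  "well_padded n (W @ [c]) \<longleftrightarrow> well_padded n W \<and> (\<exists>i<n. c ! i \<noteq> None) \<and>
     (case last_letter W of None \<Rightarrow> True | Some d \<Rightarrow> \<forall>i<n. d ! i = None \<longrightarrow> c ! i = None)"
  by (cases W rule: rev_cases) (auto simp: well_padded_def successively_append_iff)

lemma successively_take: "successively P xs \<Longrightarrow> successively P (take t xs)"
  by (metis append_take_drop_id successively_append_iff)

lemma well_padded_take: "well_padded n W \<Longrightarrow> well_padded n (take t W)"
  unfolding well_padded_def by (auto simp: successively_take dest: in_set_takeD)

lemma well_padded_column:
  assumes "well_padded n W" "i < n"
  shows "map (\<lambda>c. c ! i) W = map Some (track i W) @ replicate (length W - length (track i W)) None"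
  using assms(1)
proof (induction W rule: rev_induct)
  case (snoc c W)
  then have IH: "map (\<lambda>c. c ! i) W =
      map Some (track i W) @ replicate (length W - length (track i W)) None"
    by (simp add: well_padded_snoc)
  have len: "length (track i W) \<le> length W"
    using IH by (metis le_add1 length_append length_map)
  show ?case
  proof (cases "c ! i")
    case None
    then show ?thesis using IH len
      by (simp add: Suc_diff_le replicate_append_same)
  next
    case (Some x)
    \<comment> \<open>A letter arriving in component \<open>i\<close> excludes earlier padding
      there, which would have persisted to the last column of \<open>W\<close> and hence to
      \<open>c\<close>.\<close>
    have "length (track i W) = length W"
    proof (rule ccontr)
      assume neq: "length (track i W) \<noteq> length W"
      then have "W \<noteq> []" by auto
      have "last (map (\<lambda>c. c ! i) W) = None"
        unfolding IH using neq len by simp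
      then have "last W ! i = None" using \<open>W \<noteq> []\<close> by (simp add: last_map)
      moreover have "last_letter W = Some (last W)"
        using \<open>W \<noteq> []\<close> by (simp add: last_letter_def)
      ultimately show False
        using snoc.prems Some assms(2) by (auto simp: well_padded_snoc)
    qed
    then show ?thesis using IH Some by simp
  qed
qed simp

lemma length_track_le: "length (track i W) \<le> length W"
  by (induction W rule: rev_induct) (auto split: option.splits)

lemma well_padded_nth:
  assumes "well_padded n W" "i < n" "j < length W"
  shows "W ! j ! i = (if j < length (track i W) then Some (track i W ! j) else None)"
proof -
  have "W ! j ! i = map (\<lambda>c. c ! i) W ! j" using assms(3) by simp
  also have "\<dots> = (if j < length (track i W) then Some (track i W ! j) else None)"
    unfolding well_padded_column[OF assms(1,2)] using assms(3) by (auto simp: nth_append)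
  finally show ?thesis .
qed

text \<open>No column is padding in both components, so any excess length of the second word shows
  as padding in the first. This turns the length condition on rules into a test of single
  columns.\<close>

lemma well_padded_length_iff:
  assumes "well_padded 2 W"
  shows "length (track 1 W) \<le> length (track 0 W) \<longleftrightarrow> (\<forall>c\<in>set W. c ! 0 \<noteq> None)"
proof
  assume le: "length (track 1 W) \<le> length (track 0 W)"
  show "\<forall>c\<in>set W. c ! 0 \<noteq> None"
  proof
    fix c assume "c \<in> set W"
    then obtain j where j: "j < length W" "c = W ! j" by (auto simp: in_set_conv_nth)
    obtain i where i: "i < 2" "c ! i \<noteq> None"
      using assms \<open>c \<in> set W\<close> unfolding well_padded_def by blast
    then have "j < length (track i W)"
      using well_padded_nth[OF assms i(1) j(1)] j by (simp split: if_splits)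
    moreover have "i = 0 \<or> i = 1" using i(1) by auto
    ultimately have "j < length (track 0 W)" using le by auto
    then show "c ! 0 \<noteq> None"
      using well_padded_nth[OF assms _ j(1), of 0] j by simp
  qed
next
  assume full: "\<forall>c\<in>set W. c ! 0 \<noteq> None"
  then have "length (track 0 W) = length W"
    by (induction W rule: rev_induct) auto
  then show "length (track 1 W) \<le> length (track 0 W)" using length_track_le by metis
qed

lemma length_track_take:
  assumes "well_padded n W" "i < n"
  shows "length (track i (take t W)) = min t (length (track i W))"
proof (induction t)
  case (Suc t)
  show ?case
  proof (cases "t < length W")
    case True
    have "length (track i (take (Suc t) W)) =
        length (track i (take t W)) + (if t < length (track i W) then 1 else 0)"
      using True well_padded_nth[OF assms True] by (simp add: take_Suc_conv_app_nth)
    then show ?thesis using Suc by auto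
  next
    case False
    then show ?thesis using length_track_le[of i W] Suc by (simp add: min_def)
  qed
qed simp

lemma track_take:
  assumes "well_padded n W" "i < n"
  shows "track i (take t W) = take t (track i W)"
proof (rule nth_equalityI)
  show "length (track i (take t W)) = length (take t (track i W))"
    using length_track_take[OF assms] by simp
  fix j assume j: "j < length (track i (take t W))"
  then have jW: "j < length (take t W)"
    using length_track_le[of i "take t W"] by simp
  have "Some (track i (take t W) ! j) = take t W ! j ! i"
    using well_padded_nth[OF well_padded_take[OF assms(1)] assms(2) jW] j by simp
  also have "\<dots> = Some (track i W ! j)"
    using well_padded_nth[OF assms, of j] jW j length_track_take[OF assms, of t] by simp
  finally show "track i (take t W) ! j = take t (track i W) ! j"
    using jW by simp
qed

lemma foldr_max_eq:
  fixes ks :: "nat list"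
  assumes "\<And>k. k \<in> set ks \<Longrightarrow> k \<le> m" "m = 0 \<or> m \<in> set ks"
  shows "foldr max ks 0 = m"
proof -
  have ge: "k \<in> set ks \<Longrightarrow> k \<le> foldr max ks 0" for k
    by (induction ks) auto
  have "foldr max ks 0 = 0 \<or> foldr max ks 0 \<in> set ks"
    by (induction ks) (auto simp: max_def)
  then show ?thesis using assms ge by (metis le_antisym le_zero_eq not_gr_zero zero_le)
qed

lemma pad_tuple_tracks:
  assumes "well_padded n W" "\<And>c. c \<in> set W \<Longrightarrow> length c = n"
  shows "pad_tuple (map (\<lambda>i. track i W) [0..<n]) = W"
proof -
  have "foldr max (map length (map (\<lambda>i. track i W) [0..<n])) 0 = length W"
  proof (rule foldr_max_eq)
    show "length W = 0 \<or> length W \<in> set (map length (map (\<lambda>i. track i W) [0..<n]))"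
    proof (cases "W = []")
      case False
      \<comment> \<open>Some component of the last column is a letter, and its track has full
        length.\<close>
      then have "last W \<in> set W" by simp
      then obtain i where i: "i < n" "last W ! i \<noteq> None"
        using assms(1) unfolding well_padded_def by blast
      then have "length W - 1 < length (track i W)"
        using well_padded_nth[OF assms(1) i(1), of "length W - 1"] False
        by (auto simp: last_conv_nth split: if_splits)
      then have "length (track i W) = length W"
        using length_track_le[of i W] by simp
      then have "length W \<in> (\<lambda>i. length (track i W)) ` {0..<n}"
        using i(1) by (intro rev_image_eqI[of i]) auto
      then show ?thesis by (simp add: image_image comp_def)
    qed simp
  qed (auto simp: length_track_le)
  then show ?thesis
    using assms well_padded_nth[OF assms(1)]
    by (intro nth_equalityI) (auto simp: pad_tuple_def intro!: nth_equalityI)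
qed

lemma length_le_foldr_max: "w \<in> set ws \<Longrightarrow> length w \<le> foldr max (map length ws) 0"
  by (induction ws) auto

lemma well_padded_pad_tuple: "well_padded (length ws) (pad_tuple ws)"
proof -
  let ?m = "foldr max (map length ws) 0"
  have "\<exists>i<length ws. j < length (ws ! i)" if "j < ?m" for j
  proof -
    have "?m = 0 \<or> ?m \<in> length ` set ws"
      by (induction ws) (auto simp: max_def)
    then show ?thesis using that by (auto simp: in_set_conv_nth)
  qed
  moreover have "successively (\<lambda>c d. \<forall>i<length ws. c ! i = None \<longrightarrow> d ! i = None)
      (map (\<lambda>j. map (\<lambda>w. if j < length w then Some (w ! j) else None) ws) [0..<m])" for m
    by (induction m) (auto simp: successively_append_iff last_map)
  ultimately show ?thesis
    unfolding well_padded_def pad_tuple_def by fastforce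
qed

lemma track_pad_tuple:
  assumes "i < length ws"
  shows "track i (pad_tuple ws) = ws ! i"
proof -
  have "track i (map (\<lambda>j. map (\<lambda>w. if j < length w then Some (w ! j) else None) ws) [0..<m]) =
      take m (ws ! i)" for m
    by (induction m) (use assms in \<open>auto simp: take_Suc_conv_app_nth\<close>)
  then show ?thesis
    unfolding pad_tuple_def using length_le_foldr_max[OF nth_mem[OF assms]] by simp
qed

lemma pad_tuple_in_columns:
  assumes "ws \<in> listset (map lists As)"
  shows "pad_tuple ws \<in> lists (columns As)"
proof -
  have "ws ! i ! j \<in> As ! i" if "i < length As" "j < length (ws ! i)" for i j
    using assms that by (auto simp: listset_iff in_lists_conv_set)
  then show ?thesis
    using assms by (auto simp: pad_tuple_def listset_iff)
qed

text \<open>Padding and taking tracks are mutually inverse, so membership in a padded language can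
  be tested on tracks.\<close>

lemma pad_tuple_image:
  assumes "L \<subseteq> listset (map lists As)"
  shows "pad_tuple ` L = {W \<in> lists (columns As).
    well_padded (length As) W \<and> map (\<lambda>i. track i W) [0..<length As] \<in> L}"
proof (intro equalityI subsetI)
  fix W assume "W \<in> pad_tuple ` L"
  then obtain ws where ws: "ws \<in> L" "W = pad_tuple ws" by blast
  then have len: "length ws = length As" using assms by (auto simp: listset_iff)
  have "map (\<lambda>i. track i W) [0..<length As] = ws"
    unfolding ws(2) by (rule nth_equalityI) (auto simp: len track_pad_tuple)
  then show "W \<in> {W \<in> lists (columns As).
    well_padded (length As) W \<and> map (\<lambda>i. track i W) [0..<length As] \<in> L}"
    using ws assms pad_tuple_in_columns well_padded_pad_tuple[of ws] len by auto
next
  fix W assume W: "W \<in> {W \<in> lists (columns As).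
    well_padded (length As) W \<and> map (\<lambda>i. track i W) [0..<length As] \<in> L}"
  then have "pad_tuple (map (\<lambda>i. track i W) [0..<length As]) = W"
    by (intro pad_tuple_tracks) (auto simp: listset_iff)
  then show "W \<in> pad_tuple ` L" using W by (metis (mono_tags, lifting) imageI mem_Collect_eq)
qed

lemma finite_state_well_padded:
  assumes "finite \<Sigma>"
  shows "finite_state \<Sigma> (\<lambda>W. (well_padded n W, last_letter W))"
proof (rule finite_stateI)
  have "(\<lambda>W. (well_padded n W, last_letter W)) ` lists \<Sigma> \<subseteq> UNIV \<times> last_letter ` lists \<Sigma>"
    by auto
  then show "finite ((\<lambda>W. (well_padded n W, last_letter W)) ` lists \<Sigma>)"
    by (rule finite_subset)
      (use finite_state_finite[OF finite_state_last_letter[OF assms]] in auto)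
qed (auto simp: well_padded_snoc)

lemma finite_state_track:
  assumes "finite_state (As ! i) \<phi>" "i < length As"
  shows "finite_state (columns As) (\<lambda>W. \<phi> (track i W))"
proof (rule finite_stateI)
  have "(\<lambda>W. \<phi> (track i W)) ` lists (columns As) \<subseteq> \<phi> ` lists (As ! i)"
    using track_in_lists[OF _ assms(2)] by blast
  then show "finite ((\<lambda>W. \<phi> (track i W)) ` lists (columns As))"
    by (rule finite_subset) (rule finite_state_finite[OF assms(1)])
  fix u v c
  assume *: "u \<in> lists (columns As)" "v \<in> lists (columns As)" "c \<in> columns As"
    "\<phi> (track i u) = \<phi> (track i v)"
  show "\<phi> (track i (u @ [c])) = \<phi> (track i (v @ [c]))"
  proof (cases "c ! i")
    case (Some x)
    then have "x \<in> As ! i" using *(3) assms(2) by (auto simp: listset_iff dest!: spec[of _ i])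
    then show ?thesis
      using Some finite_stateD[OF assms(1) track_in_lists[OF *(1) assms(2)]
          track_in_lists[OF *(2) assms(2)] _ *(4)] by simp
  qed (use * in simp)
qed

text \<open>Being well padded is recognised with finitely many states; these are added to
  \<open>\<phi>\<close>, so that \<open>det\<close> concerns well padded words only.\<close>

lemma sync_regularI:
  assumes "\<forall>A\<in>set As. finite A" "L \<subseteq> listset (map lists As)"
    and "finite_state (columns As) \<phi>"
    and det: "\<And>U V. \<lbrakk>U \<in> lists (columns As); V \<in> lists (columns As);
      well_padded (length As) U; well_padded (length As) V; \<phi> U = \<phi> V;
      map (\<lambda>i. track i U) [0..<length As] \<in> L\<rbrakk> \<Longrightarrow> map (\<lambda>i. track i V) [0..<length As] \<in> L"
  shows "sync_regular As L"
proof -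
  have "finite_state (columns As) (\<lambda>W. ((well_padded (length As) W, last_letter W), \<phi> W))"
    by (intro finite_state_Pair finite_state_well_padded finite_columns assms)
  then have "regular_language (columns As) {W \<in> lists (columns As).
    well_padded (length As) W \<and> map (\<lambda>i. track i W) [0..<length As] \<in> L}"
    by (rule regular_language_finite_state[OF finite_columns[OF assms(1)]])
      (use det in auto)
  then show ?thesis
    unfolding sync_regular_def pad_tuple_image[OF assms(2)] using assms(2) by blast
qed


section \<open>Word length\<close>

locale marked_group = group G for G (structure) +
  fixes A :: "'a set"
  assumes finite_A: "finite A" and A_carrier: "A \<subseteq> carrier G"
    and generated: "generate G A = carrier G"
    and inv_A: "a \<in> A \<Longrightarrow> inv a \<in> A"
begin

text \<open>Membership in \<open>lists A\<close> stays atomic, so that it matches the premises of the lemmas below.\<close>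

declare in_listsD [rule del] in_listsI [rule del]

abbreviation val :: "'a list \<Rightarrow> 'a" where "val \<equiv> word_val G"

lemma val_Nil [simp]: "val [] = \<one>"
  and val_Cons [simp]: "val (a # w) = a \<otimes> val w"
  by (simp_all add: word_val_def)

lemma letter_closed [simp]: "a \<in> A \<Longrightarrow> a \<in> carrier G"
  using A_carrier by blast

lemma val_closed [simp]: "w \<in> lists A \<Longrightarrow> val w \<in> carrier G"
  by (induction w) auto

lemma val_append [simp]:
  assumes "u \<in> lists A" "v \<in> lists A"
  shows "val (u @ v) = val u \<otimes> val v"
  using assms(1) by (induction u) (use assms(2) in \<open>auto simp: m_assoc\<close>)

lemma take_lists [simp]: "w \<in> lists A \<Longrightarrow> take n w \<in> lists A"
  and drop_lists [simp]: "w \<in> lists A \<Longrightarrow> drop n w \<in> lists A"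
  and nth_letter [simp]: "w \<in> lists A \<Longrightarrow> n < length w \<Longrightarrow> w ! n \<in> A"
  using set_take_subset[of n w] set_drop_subset[of n w] nth_mem[of n w]
  unfolding in_lists_conv_set by blast+

lemma val_take_drop: "w \<in> lists A \<Longrightarrow> val (take n w) \<otimes> val (drop n w) = val w"
  using val_append[of "take n w" "drop n w"] by simp

definition inv_word :: "'a list \<Rightarrow> 'a list" where
  "inv_word w = rev (map (\<lambda>a. inv a) w)"

lemma inv_word_lists [simp]: "w \<in> lists A \<Longrightarrow> inv_word w \<in> lists A"
  by (auto simp: inv_word_def inv_A in_lists_conv_set)

lemma length_inv_word [simp]: "length (inv_word w) = length w"
  by (simp add: inv_word_def)

lemma val_inv_word [simp]: "w \<in> lists A \<Longrightarrow> val (inv_word w) = inv (val w)"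
proof (induction w)
  case (Cons a w)
  then have "val (inv_word (a # w)) = val (inv_word w @ [inv a])" by (simp add: inv_word_def)
  also have "\<dots> = inv (val w) \<otimes> inv a"
    using Cons by (subst val_append) (auto simp: inv_A)
  finally show ?case using Cons by (simp add: inv_mult_group)
qed (simp add: inv_word_def)

lemma val_surj:
  assumes "g \<in> carrier G"
  shows "\<exists>w\<in>lists A. val w = g"
proof -
  have "g \<in> generate G A" using assms generated by simp
  then show ?thesis
  proof (induction rule: generate.induct)
    case one
    then show ?case by (intro bexI[of _ "[]"]) auto
  next
    case (incl h)
    then show ?case by (intro bexI[of _ "[h]"]) auto
  next
    case (inv h)
    then show ?case by (intro bexI[of _ "[inv h]"]) (auto simp: inv_A)
  next
    case (eng g h)
    then obtain u v where "u \<in> lists A" "v \<in> lists A" "val u = g" "val v = h" by blast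
    then show ?case by (intro bexI[of _ "u @ v"]) auto
  qed
qed

definition wlen :: "'a \<Rightarrow> nat" where
  "wlen g = (LEAST n. \<exists>w\<in>lists A. length w = n \<and> val w = g)"

lemma wlen_le: "w \<in> lists A \<Longrightarrow> wlen (val w) \<le> length w"
  unfolding wlen_def by (rule Least_le) blast

lemma obtain_geodesic:
  assumes "g \<in> carrier G"
  obtains w where "w \<in> lists A" "length w = wlen g" "val w = g"
proof -
  have "\<exists>n. \<exists>w\<in>lists A. length w = n \<and> val w = g" using val_surj[OF assms] by blast
  then have "\<exists>w\<in>lists A. length w = wlen g \<and> val w = g"
    unfolding wlen_def by (rule LeastI_ex)
  then show ?thesis using that by blast
qed

lemma wlen_one [simp]: "wlen \<one> = 0"
  using wlen_le[of "[]"] by simp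

lemma wlen_mult:
  assumes "g \<in> carrier G" "h \<in> carrier G"
  shows "wlen (g \<otimes> h) \<le> wlen g + wlen h"
proof -
  obtain u v where "u \<in> lists A" "length u = wlen g" "val u = g"
    "v \<in> lists A" "length v = wlen h" "val v = h"
    using obtain_geodesic assms by metis
  then show ?thesis using wlen_le[of "u @ v"] by simp
qed

lemma wlen_inv [simp]:
  assumes "g \<in> carrier G"
  shows "wlen (inv g) = wlen g"
proof -
  have le: "wlen (inv h) \<le> wlen h" if h: "h \<in> carrier G" for h
  proof -
    obtain w where "w \<in> lists A" "length w = wlen h" "val w = h"
      using obtain_geodesic[OF h] by blast
    then show ?thesis using wlen_le[of "inv_word w"] by simp
  qed
  show ?thesis using le[OF assms] le[of "inv g"] assms by simp
qed

section \<open>Balls and distances\<close>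

definition ball :: "nat \<Rightarrow> 'a set" where
  "ball r = {x \<in> carrier G. wlen x \<le> r}"

lemma finite_ball: "finite (ball r)"
proof -
  have "ball r \<subseteq> val ` {w. set w \<subseteq> A \<and> length w \<le> r}"
  proof
    fix x assume x: "x \<in> ball r"
    then have "x \<in> carrier G" by (simp add: ball_def)
    then obtain w where "w \<in> lists A" "length w = wlen x" "val w = x" by (rule obtain_geodesic)
    then show "x \<in> val ` {w. set w \<subseteq> A \<and> length w \<le> r}"
      using x by (auto simp: ball_def in_lists_conv_set)
  qed
  then show ?thesis using finite_lists_length_le[OF finite_A] finite_surj by blast
qed

lemma wlen_mult_ge:
  assumes "g \<in> carrier G" "h \<in> carrier G"
  shows "wlen g \<le> wlen (g \<otimes> h) + wlen h"
  using wlen_mult[of "g \<otimes> h" "inv h"] assms by (simp add: m_assoc)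

lemma wlen_letter: "a \<in> A \<Longrightarrow> wlen a \<le> 1"
  using wlen_le[of "[a]"] by simp

lemma wlen_letter_bounds:
  assumes "g \<in> carrier G" "a \<in> A"
  shows "wlen (g \<otimes> a) \<le> wlen g + 1" "wlen g \<le> wlen (g \<otimes> a) + 1"
  using wlen_mult[of g a] wlen_mult_ge[of g a] wlen_letter[of a] assms by auto

lemma cancel_left [simp]: "g \<in> carrier G \<Longrightarrow> h \<in> carrier G \<Longrightarrow> inv g \<otimes> (g \<otimes> h) = h"
  "g \<in> carrier G \<Longrightarrow> h \<in> carrier G \<Longrightarrow> g \<otimes> (inv g \<otimes> h) = h"
  by (simp_all add: m_assoc[symmetric])

lemma cancel_right [simp]: "g \<in> carrier G \<Longrightarrow> h \<in> carrier G \<Longrightarrow> g \<otimes> h \<otimes> inv h = g"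
  "g \<in> carrier G \<Longrightarrow> h \<in> carrier G \<Longrightarrow> g \<otimes> inv h \<otimes> h = g"
  by (simp_all add: m_assoc)

text \<open>By left invariance this is the distance from \<open>g\<close> to \<open>h\<close> in the
  Cayley graph, see \<open>cayley_dist_eq\<close>.\<close>

abbreviation gap :: "'a \<Rightarrow> 'a \<Rightarrow> nat" where
  "gap g h \<equiv> wlen (inv g \<otimes> h)"

lemma gap_triangle:
  assumes "f \<in> carrier G" "g \<in> carrier G" "h \<in> carrier G"
  shows "gap f h \<le> gap f g + gap g h"
  using wlen_mult[of "inv f \<otimes> g" "inv g \<otimes> h"] assms by (simp add: m_assoc)

section \<open>Paths in the Cayley graph\<close>

text \<open>A path is determined by its initial vertex and its label; working with labels allows
  induction on words.\<close>

primrec edges :: "'a \<Rightarrow> 'a list \<Rightarrow> ('a \<times> 'a) list" where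
  "edges y [] = []"
| "edges y (a # w) = (y, a) # edges (y \<otimes> a) w"

lemma length_edges [simp]: "length (edges y w) = length w"
  by (induction w arbitrary: y) auto

lemma edges_eq_Nil [simp]: "[] = edges y w \<longleftrightarrow> w = []"
  by (cases w) auto

lemma path_label_edges [simp]: "path_label (edges y w) = w"
  by (induction w arbitrary: y) (auto simp: path_label_def)

lemma edges_append:
  "y \<in> carrier G \<Longrightarrow> u \<in> lists A \<Longrightarrow> v \<in> lists A \<Longrightarrow>
    edges y (u @ v) = edges y u @ edges (y \<otimes> val u) v"
  by (induction u arbitrary: y) (auto simp: m_assoc)

lemma nth_edges:
  "y \<in> carrier G \<Longrightarrow> w \<in> lists A \<Longrightarrow> i < length w \<Longrightarrow>
    edges y w ! i = (y \<otimes> val (take i w), w ! i)"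
proof (induction w arbitrary: y i)
  case (Cons a w)
  then show ?case by (cases i) (auto simp: m_assoc)
qed simp

lemma set_edges:
  assumes "y \<in> carrier G" "w \<in> lists A"
  shows "set (edges y w) = {(y \<otimes> val (take i w), w ! i) | i. i < length w}"
proof -
  have "(\<exists>i. e = edges y w ! i \<and> i < length w) \<longleftrightarrow>
      (\<exists>i. e = (y \<otimes> val (take i w), w ! i) \<and> i < length w)" for e
    by (rule ex_cong1) (auto simp: nth_edges[OF assms])
  then show ?thesis by (simp add: set_conv_nth)
qed

text \<open>The set of arcs is left open so that one argument serves both the Cayley graph and the
  spanning tree.\<close>

lemma awalk_subgraph_iff:
  assumes "verts T = carrier G" "arcs T \<subseteq> carrier G \<times> A"
    "tail T = fst" "head T = (\<lambda>(y, a). y \<otimes> a)"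
  shows "pre_digraph.awalk T x p y \<longleftrightarrow> x \<in> carrier G \<and> set p \<subseteq> arcs T \<and>
    (\<exists>w\<in>lists A. p = edges x w \<and> y = x \<otimes> val w)"
proof -
  have cas: "pre_digraph.cas T x p y \<longleftrightarrow> (\<exists>w\<in>lists A. p = edges x w \<and> y = x \<otimes> val w)"
    if "x \<in> carrier G" "set p \<subseteq> arcs T" for x
    using that
  proof (induction p arbitrary: x)
    case Nil
    then show ?case
      by (auto simp: pre_digraph.cas.simps)
  next
    case (Cons e p)
    obtain z a where e: "e = (z, a)" by fastforce
    have za: "z \<in> carrier G" "a \<in> A" using Cons.prems assms(2) e by auto
    have "pre_digraph.cas T x (e # p) y \<longleftrightarrow> z = x \<and> pre_digraph.cas T (x \<otimes> a) p y"
      by (auto simp: pre_digraph.cas.simps assms e)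
    also have "\<dots> \<longleftrightarrow> z = x \<and> (\<exists>w\<in>lists A. p = edges (x \<otimes> a) w \<and> y = x \<otimes> a \<otimes> val w)"
      using Cons.IH[of "x \<otimes> a"] Cons.prems za by auto
    also have "\<dots> \<longleftrightarrow> (\<exists>w\<in>lists A. e # p = edges x w \<and> y = x \<otimes> val w)" (is "?L \<longleftrightarrow> ?R")
    proof
      assume ?L
      then obtain w where "z = x" "w \<in> lists A" "p = edges (x \<otimes> a) w" "y = x \<otimes> a \<otimes> val w"
        by blast
      then show ?R using za e by (intro bexI[of _ "a # w"]) (auto simp: m_assoc)
    next
      assume ?R
      then obtain w where w: "w \<in> lists A" "e # p = edges x w" "y = x \<otimes> val w" by blast
      then obtain b v where "w = b # v" by (cases w) auto
      then show ?L using w za e Cons.prems(1) by (auto simp: m_assoc intro!: bexI[of _ v])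
    qed
    finally show ?case .
  qed
  show ?thesis
    unfolding pre_digraph.awalk_def assms(1) using cas by blast
qed

lemma cayley_path_iff:
  "cayley_path G A x p y \<longleftrightarrow> x \<in> carrier G \<and> (\<exists>w\<in>lists A. p = edges x w \<and> y = x \<otimes> val w)"
proof -
  have "x \<in> carrier G \<Longrightarrow> w \<in> lists A \<Longrightarrow> set (edges x w) \<subseteq> carrier G \<times> A" for x w
    by (induction w arbitrary: x) auto
  then show ?thesis
    by (subst awalk_subgraph_iff) (auto simp: cayley_graph_def)
qed

lemma cayley_dist_eq:
  assumes "x \<in> carrier G" "y \<in> carrier G"
  shows "cayley_dist G A x y = gap x y"
proof -
  have "(\<exists>p. cayley_path G A x p y \<and> length p = n) \<longleftrightarrow>
      (\<exists>w\<in>lists A. length w = n \<and> val w = inv x \<otimes> y)" for n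
  proof -
    have "y = x \<otimes> val w \<longleftrightarrow> val w = inv x \<otimes> y" if "w \<in> lists A" for w
      using assms that by auto
    then show ?thesis using assms by (auto simp: cayley_path_iff)
  qed
  then show ?thesis unfolding cayley_dist_def wlen_def by simp
qed

lemma geodesic_word_iff: "geodesic_word G A w \<longleftrightarrow> w \<in> lists A \<and> length w = wlen (val w)"
  by (auto simp: geodesic_word_def cayley_dist_eq)

lemma fellow_travel_iff:
  "u \<in> lists A \<Longrightarrow> v \<in> lists A \<Longrightarrow>
    fellow_travel G A k u v \<longleftrightarrow> (\<forall>n. gap (val (take n u)) (val (take n v)) \<le> k)"
  by (simp add: fellow_travel_def cayley_dist_eq)

lemma fellow_travel_trans:
  assumes "u \<in> lists A" "v \<in> lists A" "w \<in> lists A"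
    and "fellow_travel G A k u v" "fellow_travel G A l v w"
  shows "fellow_travel G A (k + l) u w"
proof -
  have "gap (val (take n u)) (val (take n w)) \<le> k + l" for n
  proof -
    have "gap (val (take n u)) (val (take n v)) \<le> k" "gap (val (take n v)) (val (take n w)) \<le> l"
      using assms by (auto simp: fellow_travel_iff)
    then show ?thesis
      using gap_triangle[of "val (take n u)" "val (take n v)" "val (take n w)"] assms by simp
  qed
  then show ?thesis using assms by (simp add: fellow_travel_iff)
qed

lemma fellow_travel_refl: "u \<in> lists A \<Longrightarrow> fellow_travel G A k u u"
  by (simp add: fellow_travel_iff)

lemma fellow_travel_snoc:
  assumes "u \<in> lists A" "a \<in> A"
  shows "fellow_travel G A 1 u (u @ [a])"
proof -
  have "gap (val (take n u)) (val (take n (u @ [a]))) \<le> 1" for n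
  proof (cases "n \<le> length u")
    case True
    then show ?thesis using assms by simp
  next
    case False
    then show ?thesis using assms wlen_letter[of a] by (simp add: not_le)
  qed
  then show ?thesis using assms by (simp add: fellow_travel_iff)
qed


section \<open>The normal form selected by last letters\<close>

text \<open>These are the last letters of geodesics to \<open>g\<close>.\<close>

definition back_letter :: "'a \<Rightarrow> 'a \<Rightarrow> bool" where
  "back_letter g a \<longleftrightarrow> a \<in> A \<and> wlen (g \<otimes> inv a) < wlen g"

text \<open>\<open>Eps\<close> is applied to the predicate itself, so elements with the same back
  letters get the same choice. The regularity of the normal forms rests on this.\<close>

definition nf_last :: "'a \<Rightarrow> 'a option" where
  "nf_last g = (if Ex (back_letter g) then Some (Eps (back_letter g)) else None)"

lemma nf_last_cong: "back_letter g = back_letter h \<Longrightarrow> nf_last g = nf_last h"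
  by (simp add: nf_last_def)

lemma nf_last_SomeD:
  assumes "nf_last g = Some a" "g \<in> carrier G"
  shows "a \<in> A" "wlen g = Suc (wlen (g \<otimes> inv a))" "g \<otimes> inv a \<otimes> a = g"
proof -
  have "back_letter g a"
    using assms by (auto simp: nf_last_def split: if_splits intro: someI_ex)
  then show a: "a \<in> A" and "g \<otimes> inv a \<otimes> a = g"
    and "wlen g = Suc (wlen (g \<otimes> inv a))"
    using wlen_letter_bounds[of "g" "inv a"] assms by (auto simp: back_letter_def inv_A)
qed

lemma nf_last_one [simp]: "nf_last \<one> = None"
  using nf_last_SomeD(2)[of \<one>] by (cases "nf_last \<one>") auto

lemma nf_last_eq_None:
  assumes "g \<in> carrier G"
  shows "nf_last g = None \<longleftrightarrow> g = \<one>"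
proof
  assume none: "nf_last g = None"
  obtain w where w: "w \<in> lists A" "length w = wlen g" "val w = g"
    using obtain_geodesic[OF assms] by blast
  show "g = \<one>"
  proof (cases w rule: rev_cases)
    case Nil
    then show ?thesis using w by simp
  next
    case (snoc u a)
    then have "back_letter g a"
      using w wlen_le[of u] by (auto simp: back_letter_def nf_last_def)
    then show ?thesis using none by (auto simp: nf_last_def split: if_splits)
  qed
qed simp

definition nf_word :: "'a list \<Rightarrow> bool" where
  "nf_word w \<longleftrightarrow> w \<in> lists A \<and> (\<forall>i<length w. nf_last (val (take (Suc i) w)) = Some (w ! i))"

lemma nf_word_Nil [simp]: "nf_word []"
  by (simp add: nf_word_def)

lemma nf_word_lists: "nf_word w \<Longrightarrow> w \<in> lists A"
  by (simp add: nf_word_def)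

lemma nf_word_snoc:
  "nf_word (w @ [a]) \<longleftrightarrow> nf_word w \<and> a \<in> A \<and> nf_last (val (w @ [a])) = Some a"
  by (auto simp: nf_word_def nth_append less_Suc_eq simp del: val_append)

lemma nf_word_take: "nf_word w \<Longrightarrow> nf_word (take n w)"
  by (auto simp: nf_word_def min_def)

text \<open>Every chosen letter is a back letter, so each letter of the word raises the word length
  by one.\<close>

lemma nf_word_length: "nf_word w \<Longrightarrow> length w = wlen (val w)"
proof (induction w rule: rev_induct)
  case (snoc a w)
  then have w: "nf_word w" "w \<in> lists A" "a \<in> A" "nf_last (val w \<otimes> a) = Some a"
    by (auto simp: nf_word_snoc nf_word_lists)
  then show ?case using nf_last_SomeD(2)[OF w(4)] snoc.IH by simp
qed simp

lemma last_letter_nf_word: "nf_word w \<Longrightarrow> last_letter w = nf_last (val w)"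
  by (cases w rule: rev_cases) (auto simp: nf_word_snoc simp del: val_append)

text \<open>The value determines the last letter, and cancelling it leaves equal values
  again.\<close>

lemma nf_word_unique: "nf_word u \<Longrightarrow> nf_word v \<Longrightarrow> val u = val v \<Longrightarrow> u = v"
proof (induction u arbitrary: v rule: rev_induct)
  case Nil
  then have "last_letter v = None" using last_letter_nf_word[of v] by (metis nf_last_one val_Nil)
  then show ?case by simp
next
  case (snoc a u)
  have "last_letter v = Some a"
    using last_letter_nf_word snoc.prems last_letter_simps(2) by metis
  then obtain w where v: "v = w @ [a]"
    by (cases v rule: rev_cases) auto
  then have uw: "nf_word u" "nf_word w" "a \<in> A" using snoc.prems by (auto simp: nf_word_snoc)
  then have "val u \<otimes> a = val w \<otimes> a" using snoc.prems v by (simp add: nf_word_lists)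
  then have "val u = val w" using uw by (simp add: nf_word_lists)
  then show ?case using snoc.IH uw v by simp
qed

lemma nf_word_exists: "g \<in> carrier G \<Longrightarrow> \<exists>w. nf_word w \<and> val w = g"
proof (induction "wlen g" arbitrary: g rule: less_induct)
  case less
  show ?case
  proof (cases "nf_last g")
    case None
    then show ?thesis using less.prems nf_last_eq_None by (metis nf_word_Nil val_Nil)
  next
    case (Some a)
    note a = nf_last_SomeD[OF Some less.prems]
    then obtain w where "nf_word w" "val w = g \<otimes> inv a"
      using less.hyps[of "g \<otimes> inv a"] less.prems by auto
    then show ?thesis
      using a Some less.prems by (intro exI[of _ "w @ [a]"]) (auto simp: nf_word_snoc nf_word_lists)
  qed
qed

definition nf :: "'a \<Rightarrow> 'a list" where
  "nf g = (THE w. nf_word w \<and> val w = g)"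

lemma nf_equality: "nf_word w \<Longrightarrow> nf (val w) = w"
  unfolding nf_def using nf_word_unique by (intro the_equality) auto

lemma
  assumes "g \<in> carrier G"
  shows nf_word_nf: "nf_word (nf g)" and val_nf [simp]: "val (nf g) = g"
    and length_nf: "length (nf g) = wlen g"
  using nf_word_exists[OF assms] nf_equality nf_word_length by metis+

lemma nf_lists [simp]: "g \<in> carrier G \<Longrightarrow> nf g \<in> lists A"
  using nf_word_nf nf_word_lists by blast

section \<open>The spanning tree of normal forms\<close>

abbreviation up_edge :: "'a \<Rightarrow> 'a \<Rightarrow> bool" where
  "up_edge y a \<equiv> nf_last (y \<otimes> a) = Some a"

abbreviation down_edge :: "'a \<Rightarrow> 'a \<Rightarrow> bool" where
  "down_edge y a \<equiv> nf_last y = Some (inv a)"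

definition tree_edge :: "'a \<Rightarrow> 'a \<Rightarrow> bool" where
  "tree_edge y a \<longleftrightarrow> up_edge y a \<or> down_edge y a"

definition nf_tree :: "('a, 'a \<times> 'a) pre_digraph" where
  "nf_tree = \<lparr>verts = carrier G, arcs = {(y, a). y \<in> carrier G \<and> a \<in> A \<and> tree_edge y a},
     tail = fst, head = (\<lambda>(y, a). y \<otimes> a)\<rparr>"

lemma up_edge_wlen:
  assumes "y \<in> carrier G" "a \<in> A" "up_edge y a"
  shows "wlen (y \<otimes> a) = Suc (wlen y)"
  using nf_last_SomeD(2)[OF assms(3)] assms by simp

lemma down_edge_wlen:
  assumes "y \<in> carrier G" "a \<in> A" "down_edge y a"
  shows "wlen y = Suc (wlen (y \<otimes> a))"
  using nf_last_SomeD(2)[OF assms(3)] assms by simp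

lemma awalk_nf_tree_iff:
  "pre_digraph.awalk nf_tree x p y \<longleftrightarrow> x \<in> carrier G \<and>
    (\<exists>w\<in>lists A. p = edges x w \<and> y = x \<otimes> val w \<and> (\<forall>(z, c)\<in>set p. tree_edge z c))"
proof -
  have "w \<in> lists A \<Longrightarrow> x \<in> carrier G \<Longrightarrow> set (edges x w) \<subseteq> carrier G \<times> A" for w
    by (induction w arbitrary: x) auto
  then have "w \<in> lists A \<Longrightarrow> x \<in> carrier G \<Longrightarrow>
      set (edges x w) \<subseteq> arcs nf_tree \<longleftrightarrow> (\<forall>(z, c)\<in>set (edges x w). tree_edge z c)" for w
    by (fastforce simp: nf_tree_def)
  then show ?thesis
    by (subst awalk_subgraph_iff) (auto simp: nf_tree_def)
qed

lemma nf_word_up_edges: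
  assumes "w \<in> lists A"
  shows "nf_word w \<longleftrightarrow> (\<forall>(z, c)\<in>set (edges \<one> w). up_edge z c)"
proof -
  have "val (take (Suc i) w) = \<one> \<otimes> val (take i w) \<otimes> w ! i" if "i < length w" for i
    using that assms by (simp add: take_Suc_conv_app_nth)
  then show ?thesis using assms by (auto simp: nf_word_def set_edges)
qed

lemma nf_word_tree_edges: "nf_word w \<Longrightarrow> (z, c) \<in> set (edges \<one> w) \<Longrightarrow> tree_edge z c"
  using nf_word_up_edges[of w] nf_word_lists by (auto simp: tree_edge_def)

text \<open>Walking back along a normal form reverses the edges by which its vertices are entered.
  The parameter \<open>m\<close> is the position where the descent stops; \<open>m = 0\<close> leads
  to the identity.\<close>

lemma nf_word_descent:
  "nf_word w \<Longrightarrow> (z, c) \<in> set (edges (val w) (inv_word (drop m w))) \<Longrightarrow> tree_edge z c"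
proof (induction w rule: rev_induct)
  case (snoc b w)
  then have w: "nf_word w" "w \<in> lists A" "b \<in> A" "nf_last (val w \<otimes> b) = Some b"
    by (auto simp: nf_word_snoc nf_word_lists)
  show ?case
  proof (cases "m \<le> length w")
    case True
    then have "inv_word (drop m (w @ [b])) = inv b # inv_word (drop m w)"
      by (simp add: inv_word_def)
    then have "(z, c) = (val w \<otimes> b, inv b) \<or> (z, c) \<in> set (edges (val w) (inv_word (drop m w)))"
      using snoc.prems w by simp
    then show ?thesis using w snoc.IH by (auto simp: tree_edge_def)
  next
    case False
    then show ?thesis using snoc.prems by (simp add: inv_word_def)
  qed
qed (simp add: inv_word_def)

text \<open>At the end of an upward edge labelled \<open>a\<close> the chosen letter is
  \<open>a\<close>, so the only downward edge from there is the same edge reversed, which is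
  forbidden.\<close>

lemma up_edges_propagate:
  assumes "x \<in> carrier G" "w \<in> lists A" "\<forall>(z, c)\<in>set (edges x w). tree_edge z c"
    and "non_backtracking G (edges x w)" "w \<noteq> [] \<Longrightarrow> up_edge x (hd w)"
  shows "\<forall>(z, c)\<in>set (edges x w). up_edge z c"
  using assms
proof (induction w arbitrary: x)
  case (Cons a w)
  then have a: "x \<in> carrier G" "a \<in> A" "w \<in> lists A" "up_edge x a" by auto
  have "up_edge (x \<otimes> a) (hd w)" if "w \<noteq> []"
  proof (rule ccontr)
    obtain b w' where w: "w = b # w'" using \<open>w \<noteq> []\<close> by (cases w) auto
    assume "\<not> up_edge (x \<otimes> a) (hd w)"
    then have "down_edge (x \<otimes> a) b" using Cons.prems w by (auto simp: tree_edge_def)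
    then have "inv a = inv (inv b)" using a by simp
    then have "b = inv a" using a w by simp
    then show False
      using Cons.prems(4) w by (simp add: non_backtracking_def edge_inv_def)
  qed
  moreover have "non_backtracking G (edges (x \<otimes> a) w)"
    using Cons.prems(4) by (cases w) (auto simp: non_backtracking_def)
  ultimately show ?case using Cons.IH[of "x \<otimes> a"] Cons.prems by auto
qed simp

lemma up_edges_wlen:
  "x \<in> carrier G \<Longrightarrow> w \<in> lists A \<Longrightarrow> \<forall>(z, c)\<in>set (edges x w). up_edge z c \<Longrightarrow>
    wlen (x \<otimes> val w) = wlen x + length w"
proof (induction w arbitrary: x)
  case (Cons a w)
  then show ?case using up_edge_wlen[of x a] Cons.IH[of "x \<otimes> a"] by (simp add: m_assoc)
qed simp

lemma down_edges_wlen: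
  "x \<in> carrier G \<Longrightarrow> w \<in> lists A \<Longrightarrow> \<forall>(z, c)\<in>set (edges x w). down_edge z c \<Longrightarrow>
    wlen x = wlen (x \<otimes> val w) + length w"
proof (induction w arbitrary: x)
  case (Cons a w)
  then show ?case using down_edge_wlen[of x a] Cons.IH[of "x \<otimes> a"] by (simp add: m_assoc)
qed simp

lemma non_backtracking_append:
  "non_backtracking G (p @ q) \<Longrightarrow> non_backtracking G p \<and> non_backtracking G q"
  by (simp add: non_backtracking_def successively_append_iff)

text \<open>
  A walk in the tree without backtracking descends first and ascends afterwards. If it is
  closed, its first and last edges are therefore mutually inverse and can be removed.
\<close>

lemma nf_tree_no_closed_walk:
  assumes "x \<in> carrier G" "w \<in> lists A" "\<forall>(z, c)\<in>set (edges x w). tree_edge z c"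
    and "non_backtracking G (edges x w)" "x \<otimes> val w = x"
  shows "w = []"
  using assms
proof (induction "length w" arbitrary: x w rule: less_induct)
  case less
  note x = less.prems(1) and w = less.prems(2) and tree = less.prems(3)
  show ?case
  proof (rule ccontr)
    assume "w \<noteq> []"
    then obtain a w1 where w1: "w = a # w1" by (cases w) auto
    obtain w2 b where w2: "w = w2 @ [b]" using \<open>w \<noteq> []\<close> by (cases w rule: rev_cases) auto
    have A: "a \<in> A" "w1 \<in> lists A" "w2 \<in> lists A" "b \<in> A"
      using w w[unfolded w1] w[unfolded w2] by auto
    have last_edge: "(x \<otimes> val w2, b) \<in> set (edges x w)"
      using x A by (simp add: w2 edges_append)
    have end_x: "x \<otimes> val w2 \<otimes> b = x" using less.prems(5) x A by (simp add: w2 m_assoc)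
    \<comment> \<open>An upward first edge would make all edges upward, and a closed walk cannot
      gain length.\<close>
    have "\<not> up_edge x a"
    proof
      assume "up_edge x a"
      then have "\<forall>(z, c)\<in>set (edges x w). up_edge z c"
        using up_edges_propagate[OF less.prems(1-4)] w1 by simp
      then show False using up_edges_wlen[OF x w] less.prems(5) w1 by simp
    qed
    then have down: "down_edge x a" using tree w1 by (auto simp: tree_edge_def)
    \<comment> \<open>This says that the last edge, which ends at \<open>x\<close>, goes up.
      Otherwise no edge goes up, since upward motion would propagate to the last edge, and the walk
      would only lose length.\<close>
    have "nf_last x = Some b"
    proof (rule ccontr)
      assume not_up: "nf_last x \<noteq> Some b"
      have "down_edge z c" if zc: "(z, c) \<in> set (edges x w)" for z c
      proof (rule ccontr)
        assume "\<not> down_edge z c"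
        then have up: "up_edge z c" using tree zc by (auto simp: tree_edge_def)
        obtain i where i: "i < length w" "z = x \<otimes> val (take i w)" "c = w ! i"
          using zc x w by (auto simp: set_edges)
        have z: "z \<in> carrier G" using i x w by simp
        have split: "edges x w = edges x (take i w) @ edges z (drop i w)"
          using edges_append[OF x, of "take i w" "drop i w"] w i by simp
        have nb: "non_backtracking G (edges z (drop i w))"
          using less.prems(4) non_backtracking_append unfolding split by blast
        have "\<forall>(z, c)\<in>set (edges z (drop i w)). tree_edge z c"
          using tree unfolding split set_append by blast
        from up_edges_propagate[OF z drop_lists[OF w] this nb]
        have "\<forall>(z, c)\<in>set (edges z (drop i w)). up_edge z c"
          using up i by (simp add: hd_drop_conv_nth)
        moreover have "drop i w = drop i w2 @ [b]" using i w2 by simp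
        then have "(z \<otimes> val (drop i w2), b) \<in> set (edges z (drop i w))"
          using i x w A by (simp add: edges_append)
        moreover have "z \<otimes> val (drop i w2) = x \<otimes> val w2"
          using i x A w2 val_take_drop[of w2 i] by (simp add: m_assoc)
        ultimately show False using not_up end_x by auto
      qed
      then show False using down_edges_wlen[OF x w] less.prems(5) w1 by auto
    qed
    then have b: "b = inv a" using down by simp
    have "w1 \<noteq> []"
      using down_edge_wlen[OF x A(1) down] less.prems(5) x A w1 by auto
    then obtain q where w1q: "w1 = q @ [b]" using w1 w2 by (cases w1 rule: rev_cases) auto
    \<comment> \<open>Conjugating by the first edge gives a shorter closed walk at its other
      end.\<close>
    have q: "q \<in> lists A" "x \<otimes> a \<otimes> val q = x \<otimes> a"
    proof -
      show q: "q \<in> lists A" using A w1q by simp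
      have "x \<otimes> a \<otimes> val q \<otimes> inv a = x"
        using less.prems(5) x A q b by (simp add: w1 w1q m_assoc inv_A)
      then show "x \<otimes> a \<otimes> val q = x \<otimes> a"
        using x A q inv_solve_right'[of x "x \<otimes> a \<otimes> val q" a] by simp
    qed
    have edges: "edges x w = [(x, a)] @ edges (x \<otimes> a) q @ [(x \<otimes> a, inv a)]"
      using x A q b by (simp add: w1 w1q edges_append)
    \<comment> \<open>For empty \<open>q\<close> the first edge would be followed at once by its
      inverse.\<close>
    then have "q \<noteq> []"
      using less.prems(4) by (auto simp: non_backtracking_def edge_inv_def)
    moreover have "non_backtracking G (edges (x \<otimes> a) q)"
      using less.prems(4) edges non_backtracking_append by metis
    then have "q = []"
      using less.hyps[of q "x \<otimes> a"] less.prems(3) edges x A q by (simp add: w1 w1q)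
    ultimately show False by simp
  qed
qed

text \<open>No tree edge goes down from the identity, so such a walk starts upward and stays upward;
  its label is then a normal form.\<close>

lemma non_backtracking_from_one_iff:
  assumes "g \<in> carrier G"
  shows "pre_digraph.awalk nf_tree \<one> p g \<and> non_backtracking G p \<longleftrightarrow> p = edges \<one> (nf g)"
proof
  assume *: "pre_digraph.awalk nf_tree \<one> p g \<and> non_backtracking G p"
  then obtain w where w: "w \<in> lists A" "p = edges \<one> w" "g = \<one> \<otimes> val w"
    "\<forall>(z, c)\<in>set p. tree_edge z c" by (auto simp: awalk_nf_tree_iff)
  have "up_edge \<one> (hd w)" if "w \<noteq> []"
  proof -
    obtain a v where "w = a # v" using \<open>w \<noteq> []\<close> by (cases w) auto
    then show ?thesis using w by (auto simp: tree_edge_def)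
  qed
  then have "nf_word w"
    using up_edges_propagate[of \<one> w] w * nf_word_up_edges by auto
  then have "nf g = w" using nf_equality w by simp
  then show "p = edges \<one> (nf g)" using w by simp
next
  assume p: "p = edges \<one> (nf g)"
  have nf: "nf_word (nf g)" by (rule nf_word_nf[OF assms])
  \<comment> \<open>Two consecutive upward edges raise the length twice, whereas an edge followed by
    its inverse returns to its start.\<close>
  have "successively (\<lambda>e e'. e' \<noteq> edge_inv G e) (edges x w)"
    if "\<forall>(z, c)\<in>set (edges x w). up_edge z c" "x \<in> carrier G" "w \<in> lists A" for x w
    using that
  proof (induction w arbitrary: x rule: induct_list012)
    case (3 a b w)
    then have "(x \<otimes> a, b) \<noteq> edge_inv G (x, a)"
      using up_edge_wlen[of x a] up_edge_wlen[of "x \<otimes> a" b] by (auto simp: edge_inv_def)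
    then show ?case using 3 by simp
  qed auto
  then have "non_backtracking G p"
    using nf_word_up_edges[of "nf g"] nf assms unfolding p non_backtracking_def by simp
  moreover have "pre_digraph.awalk nf_tree \<one> p g"
    unfolding awalk_nf_tree_iff using assms nf nf_word_tree_edges p by (auto intro!: bexI[of _ "nf g"])
  ultimately show "pre_digraph.awalk nf_tree \<one> p g \<and> non_backtracking G p" by simp
qed

lemma tree_nf_eq: "g \<in> carrier G \<Longrightarrow> tree_nf G nf_tree g = nf g"
  unfolding tree_nf_def by (simp add: non_backtracking_from_one_iff)

lemma wf_digraph_nf_tree: "wf_digraph nf_tree" and wf_digraph_cayley: "wf_digraph (cayley_graph G A)"
  by (unfold_locales; auto simp: nf_tree_def cayley_graph_def)+

lemma cayley_spanning_tree_nf_tree: "cayley_spanning_tree G A nf_tree"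
  unfolding cayley_spanning_tree_def
proof (intro conjI ballI notI)
  show "spanning nf_tree (cayley_graph G A)"
    using wf_digraph_nf_tree wf_digraph_cayley
    by (auto simp: spanning_def subgraph_def compatible_def nf_tree_def cayley_graph_def)
  show "edge_inv G e \<in> arcs nf_tree" if "e \<in> arcs nf_tree" for e
    using that by (auto simp: nf_tree_def edge_inv_def inv_A tree_edge_def)
  show "strongly_connected nf_tree"
    unfolding strongly_connected_def
  proof (intro conjI ballI)
    show "verts nf_tree \<noteq> {}" by (auto simp: nf_tree_def)
    fix u v assume "u \<in> verts nf_tree" "v \<in> verts nf_tree"
    then have uv: "u \<in> carrier G" "v \<in> carrier G" by (auto simp: nf_tree_def)
    \<comment> \<open>Any two vertices are joined through the identity.\<close>
    define w where "w = inv_word (nf u) @ nf v"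
    have w: "w \<in> lists A" "u \<otimes> val w = v" using uv by (auto simp: w_def)
    have "edges u w = edges u (inv_word (nf u)) @ edges \<one> (nf v)"
      using uv by (simp add: w_def edges_append)
    then have "\<forall>(z, c)\<in>set (edges u w). tree_edge z c"
      using nf_word_descent[OF nf_word_nf, of u _ _ 0] nf_word_tree_edges[OF nf_word_nf, of v] uv
      by auto
    then have "pre_digraph.awalk nf_tree u (edges u w) v"
      unfolding awalk_nf_tree_iff using w uv by auto
    then show "u \<rightarrow>\<^sup>*\<^bsub>nf_tree\<^esub> v"
      by (rule wf_digraph.reachable_awalkI[OF wf_digraph_nf_tree])
  qed
  assume "\<exists>x p. p \<noteq> [] \<and> pre_digraph.awalk nf_tree x p x \<and> non_backtracking G p"
  then show False
    using nf_tree_no_closed_walk by (fastforce simp: awalk_nf_tree_iff)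
qed

end


section \<open>Defects under falsification by fellow traveler\<close>

locale fftp_group = marked_group +
  fixes k :: nat
  assumes shorten: "u \<in> lists A \<Longrightarrow> wlen (val u) < length u \<Longrightarrow>
    \<exists>v\<in>lists A. length v < length u \<and> val v = val u \<and> fellow_travel G A k u v"
begin

lemma fellow_travel_mono: "fellow_travel G A i u v \<Longrightarrow> i \<le> j \<Longrightarrow> fellow_travel G A j u v"
  unfolding fellow_travel_def by (meson le_trans)

text \<open>Each shortening adds at most \<open>k\<close> to the fellow travel constant.\<close>

lemma shorten_iterate:
  assumes "u \<in> lists A" "wlen (val u) + j \<le> length u"
  shows "\<exists>v\<in>lists A. length v + j \<le> length u \<and> val v = val u \<and> fellow_travel G A (j * k) u v"
  using assms(2)
proof (induction j)
  case 0
  then show ?case using assms(1) fellow_travel_refl by auto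
next
  case (Suc j)
  then obtain v where v: "v \<in> lists A" "length v + j \<le> length u" "val v = val u"
    "fellow_travel G A (j * k) u v" by auto
  show ?case
  \<comment> \<open>A single shortening may remove several letters; then the word at hand may
    already be short enough.\<close>
  proof (cases "length v + Suc j \<le> length u")
    case True
    then show ?thesis using v fellow_travel_mono[OF v(4), of "Suc j * k"] by auto
  next
    case False
    then obtain v' where v': "v' \<in> lists A" "length v' < length v" "val v' = val v"
      "fellow_travel G A k v v'"
      using shorten[OF v(1)] v Suc.prems by auto
    have "fellow_travel G A (j * k + k) u v'"
      by (rule fellow_travel_trans[OF assms(1) v(1) v'(1) v(4) v'(4)])
    then show ?thesis using v v' by (intro bexI[of _ v']) (auto simp: add.commute)
  qed
qed

text \<open>The number of shortenings is the exact excess of \<open>u\<close>, after which no excess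
  can remain.\<close>

lemma geodesic_fellow_traveler:
  assumes "u \<in> lists A" "length u \<le> wlen (val u) + j"
  shows "\<exists>v\<in>lists A. length v = wlen (val u) \<and> val v = val u \<and> fellow_travel G A (j * k) u v"
proof -
  define i where "i = length u - wlen (val u)"
  have i: "wlen (val u) + i = length u" "i \<le> j"
    using wlen_le[OF assms(1)] assms(2) by (auto simp: i_def)
  then obtain v where v: "v \<in> lists A" "length v + i \<le> length u" "val v = val u"
    "fellow_travel G A (i * k) u v"
    using shorten_iterate[OF assms(1), of i] by auto
  then have "length v = wlen (val u)" using wlen_le[OF v(1)] i by simp
  then show ?thesis using v i fellow_travel_mono[OF v(4), of "j * k"] by auto
qed

text \<open>For positive \<open>J\<close> the words over \<open>A\<close> of defect zero form the
  cone type of \<open>g\<close>. The default zero makes agreement on words the same as equality of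
  functions.\<close>

definition defect :: "nat \<Rightarrow> 'a \<Rightarrow> 'a list \<Rightarrow> nat" where
  "defect J g w = (if w \<in> lists A then min J (wlen g + length w - wlen (g \<otimes> val w)) else 0)"

text \<open>The default zero off the finite ball leaves only finitely many functions, the values
  being bounded by \<open>r\<close>.\<close>

definition level :: "nat \<Rightarrow> 'a \<Rightarrow> 'a \<Rightarrow> int" where
  "level r g x = (if x \<in> ball r then int (wlen (g \<otimes> x)) - int (wlen g) else 0)"

lemma finite_levels: "finite (level r ` carrier G)"
proof -
  have "level r ` carrier G \<subseteq>
    {f. \<forall>x. (x \<in> ball r \<longrightarrow> f x \<in> {- int r..int r}) \<and> (x \<notin> ball r \<longrightarrow> f x = 0)}"
  proof (intro image_subsetI CollectI allI conjI impI)
    fix g x assume g: "g \<in> carrier G" and "x \<in> ball r"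
    then have "x \<in> carrier G" "wlen x \<le> r" by (auto simp: ball_def)
    then show "level r g x \<in> {- int r..int r}"
      using wlen_mult[OF g, of x] wlen_mult_ge[OF g, of x] by (auto simp: level_def)
  qed (simp add: level_def)
  then show ?thesis
    by (rule finite_subset) (rule finite_set_of_finite_funs[OF finite_ball finite_atLeastAtMost_int])
qed

text \<open>
  A word whose path from \<open>g\<close> loses at least \<open>j\<close> against the geodesic prefix can be
  shortened in \<open>j\<close> steps, and the result passes within \<open>j * k\<close> of \<open>g\<close>. Only the
  relative lengths around \<open>g\<close> matter for the loss, so it also occurs at \<open>h\<close>.
\<close>

lemma level_defect_transfer:
  assumes g: "g \<in> carrier G" and h: "h \<in> carrier G"
    and level: "level (J * k) g = level (J * k) h" and w: "w \<in> lists A"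
    and "j \<le> J" and loss: "wlen (g \<otimes> val w) + j \<le> wlen g + length w"
  shows "wlen (h \<otimes> val w) + j \<le> wlen h + length w"
proof -
  obtain u where u: "u \<in> lists A" "length u = wlen g" "val u = g"
    using obtain_geodesic[OF g] by blast
  have "wlen (val (u @ w)) + j \<le> length (u @ w)" using u w loss by simp
  then obtain v where v: "v \<in> lists A" "length v + j \<le> length (u @ w)" "val v = val (u @ w)"
    "fellow_travel G A (j * k) (u @ w) v"
    using shorten_iterate[of "u @ w" j] u w by auto
  define n where "n = wlen g"
  \<comment> \<open>The shortened word \<open>v\<close> is cut at the time \<open>n\<close> when the
    original path passes through \<open>g\<close>. Its remainder, attached at
    \<open>h \<otimes> x\<close>, leads to \<open>h \<otimes> val w\<close>.\<close>
  define x where "x = inv g \<otimes> val (take n v)"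
  have x: "x \<in> carrier G" unfolding x_def using g v(1) by simp
  have gx: "g \<otimes> x = val (take n v)" unfolding x_def using g v(1) by simp
  have "gap (val (take n (u @ w))) (val (take n v)) \<le> j * k"
    using v u w by (simp add: fellow_travel_iff)
  then have "wlen x \<le> j * k" using u by (simp add: n_def x_def)
  then have "wlen x \<le> J * k" using mult_le_mono1[OF \<open>j \<le> J\<close>] le_trans by blast
  then have "x \<in> ball (J * k)" using x by (simp add: ball_def)
  then have eq: "int (wlen (h \<otimes> x)) - int (wlen h) = int (wlen (g \<otimes> x)) - int n"
    using fun_cong[OF level, of x] by (simp add: level_def n_def)
  have "g \<otimes> (x \<otimes> val (drop n v)) = g \<otimes> val w"
    using g x v u w gx val_take_drop[OF v(1), of n] by (simp add: m_assoc[symmetric])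
  then have "x \<otimes> val (drop n v) = val w" using g x v(1) w by simp
  then have "wlen (h \<otimes> val w) \<le> wlen (h \<otimes> x) + wlen (val (drop n v))"
    using wlen_mult[of "h \<otimes> x" "val (drop n v)"] h x v(1) by (simp add: m_assoc)
  moreover have "wlen (val (drop n v)) \<le> length v - n" using wlen_le[of "drop n v"] v(1) by simp
  \<comment> \<open>The bound by \<open>length v\<close> covers the case that \<open>v\<close> ends
    before time \<open>n\<close>, where \<open>length v - n\<close> is truncated to zero.\<close>
  moreover have "wlen (g \<otimes> x) \<le> min n (length v)"
    using wlen_le[of "take n v"] v(1) gx by (simp add: min.commute)
  ultimately show ?thesis using eq v(2) u by (auto simp: n_def)
qed

lemma defect_le:
  assumes "w \<in> lists A" "g \<in> carrier G"
  shows "defect J g w \<le> J" "wlen (g \<otimes> val w) + defect J g w \<le> wlen g + length w"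
  using wlen_mult[of g "val w"] wlen_le[of w] assms by (auto simp: defect_def)

text \<open>The defect is itself a loss of at most \<open>J\<close>, so it transfers in both
  directions.\<close>

lemma level_imp_defect:
  assumes g: "g \<in> carrier G" and h: "h \<in> carrier G" and level: "level (J * k) g = level (J * k) h"
  shows "defect J g = defect J h"
proof
  have "defect J f w \<le> defect J f' w" if "f \<in> carrier G" "f' \<in> carrier G"
    "level (J * k) f = level (J * k) f'" "w \<in> lists A" for f f' w
    using level_defect_transfer[OF that defect_le[OF that(4,1)]] defect_le[OF that(4,1), of J] that
    by (simp add: defect_def)
  note le = this
  fix w
  show "defect J g w = defect J h w"
    using le[OF g h level] le[OF h g level[symmetric]]
    by (cases "w \<in> lists A") (auto intro: antisym simp: defect_def)
qed

lemma finite_defects: "finite (defect J ` carrier G)"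
  by (rule finite_image_determined[OF finite_levels[of "J * k"] level_imp_defect])

text \<open>The first letter loses nothing, so continuing from \<open>g \<otimes> a\<close> along
  \<open>w\<close> has the excess of \<open>a # w\<close> at \<open>g\<close>. Hence the old
  function determines the new one with the same cap.\<close>

lemma defect_step:
  assumes "g \<in> carrier G" "a \<in> A" "wlen (g \<otimes> a) = Suc (wlen g)"
  shows "defect J (g \<otimes> a) = (\<lambda>w. if w \<in> lists A then defect J g (a # w) else 0)"
  using assms by (auto simp: defect_def fun_eq_iff m_assoc)

text \<open>A word loses at most twice its length, so the cap has no effect and relative lengths can
  be recovered.\<close>

lemma defect_cong_wlen:
  assumes "g \<in> carrier G" "h \<in> carrier G" "defect J g = defect J h"
    and "w \<in> lists A" "2 * length w \<le> J"
  shows "wlen (g \<otimes> val w) + wlen h = wlen (h \<otimes> val w) + wlen g"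
proof -
  have "wlen (f \<otimes> val w) + defect J f w = wlen f + length w" if "f \<in> carrier G" for f
    using wlen_mult[of f "val w"] wlen_mult_ge[of f "val w"] wlen_le[of w] assms(4,5) that
    by (simp add: defect_def)
  from this[OF assms(1)] this[OF assms(2)] show ?thesis using assms(3) by simp
qed

text \<open>Back letters are detected by words with one more letter, hence the \<open>Suc\<close> in
  the bound.\<close>

lemma defect_cong_nf_last:
  assumes "g \<in> carrier G" "h \<in> carrier G" "defect J g = defect J h"
    and "w \<in> lists A" "2 * Suc (length w) \<le> J"
  shows "nf_last (g \<otimes> val w) = nf_last (h \<otimes> val w)"
proof (rule nf_last_cong, rule ext)
  fix a
  show "back_letter (g \<otimes> val w) a \<longleftrightarrow> back_letter (h \<otimes> val w) a"
  proof (cases "a \<in> A")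
    case True
    then show ?thesis
      using defect_cong_wlen[OF assms(1-4)] defect_cong_wlen[OF assms(1-3), of "w @ [inv a]"] assms
      by (auto simp: back_letter_def inv_A m_assoc)
  qed (simp add: back_letter_def)
qed

section \<open>Recognising normal forms\<close>

definition nf_state :: "nat \<Rightarrow> 'a list \<Rightarrow> ('a list \<Rightarrow> nat) option" where
  "nf_state J w = (if nf_word w then Some (defect J (val w)) else None)"

text \<open>\<open>None\<close> is an absorbing failure state. Otherwise the defect decides whether
  the next letter is the chosen one, and \<open>defect_step\<close> updates it. The bound four
  allows for \<open>nf_last\<close> one letter ahead.\<close>

lemma finite_state_nf_state:
  assumes "4 \<le> J"
  shows "finite_state A (nf_state J)"
proof (rule finite_stateI)
  have "nf_state J ` lists A \<subseteq> insert None (Some ` defect J ` carrier G)"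
    by (auto simp: nf_state_def)
  then show "finite (nf_state J ` lists A)"
    by (rule finite_subset) (use finite_defects in auto)
  fix u v c
  assume *: "u \<in> lists A" "v \<in> lists A" "c \<in> A" "nf_state J u = nf_state J v"
  show "nf_state J (u @ [c]) = nf_state J (v @ [c])"
  proof (cases "nf_word u")
    case False
    then have "\<not> nf_word v" using * by (auto simp: nf_state_def split: if_splits)
    then show ?thesis using False by (simp add: nf_state_def nf_word_snoc)
  next
    case True
    then have nf: "nf_word u" "nf_word v" and eq: "defect J (val u) = defect J (val v)"
      using * by (auto simp: nf_state_def split: if_splits)
    have last: "nf_last (val u \<otimes> c) = nf_last (val v \<otimes> c)"
      using defect_cong_nf_last[OF _ _ eq, of "[c]"] * assms by simp
    show ?thesis
    proof (cases "nf_last (val v \<otimes> c) = Some c")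
      case True
      have step: "defect J (val x \<otimes> c) = (\<lambda>w. if w \<in> lists A then defect J (val x) (c # w) else 0)"
        if "x \<in> lists A" "nf_last (val x \<otimes> c) = Some c" for x
        using nf_last_SomeD(2)[OF that(2)] that * by (intro defect_step) auto
      have "defect J (val u \<otimes> c) = defect J (val v \<otimes> c)"
        unfolding step[OF \<open>u \<in> lists A\<close> last[unfolded True]] step[OF \<open>v \<in> lists A\<close> True] eq ..
      then show ?thesis using nf last True * by (simp add: nf_state_def nf_word_snoc)
    next
      case False
      then show ?thesis using last * by (simp add: nf_state_def nf_word_snoc)
    qed
  qed
qed

text \<open>
  If \<open>b\<close> is the prescribed last letter at \<open>y a\<close>, then \<open>nf y\<close> followed by \<open>a\<close> and the
  inverse of \<open>b\<close> is at most four letters longer than a geodesic, so four shortenings suffice.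
\<close>

lemma target_word:
  assumes y: "y \<in> carrier G" and a: "a \<in> A"
  shows "\<exists>v\<in>lists A. val v = y \<otimes> a \<and> length v = wlen (y \<otimes> a) \<and>
    last_letter v = nf_last (y \<otimes> a) \<and> fellow_travel G A (4 * k + 2) (nf y @ [a]) v"
proof (cases "nf_last (y \<otimes> a)")
  \<comment> \<open>The target is the empty word here, and \<open>nf y @ [a]\<close> has at most two
    letters.\<close>
  case None
  then have one: "y \<otimes> a = \<one>" using nf_last_eq_None y a by simp
  then have "inv a = y" using y a inv_equality by simp
  then have "wlen y \<le> 1" using wlen_letter[OF a] wlen_inv[of a] a by simp
  then have "length (nf y @ [a]) \<le> 2" using length_nf[OF y] by simp
  moreover have "gap (val (take n (nf y @ [a]))) (val (take n [])) \<le> length (nf y @ [a])" for n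
  proof -
    have "gap (val (take n (nf y @ [a]))) \<one> = wlen (val (take n (nf y @ [a])))"
      using y a take_lists[of "nf y @ [a]" n] by (simp del: take_append)
    also have "\<dots> \<le> length (take n (nf y @ [a]))"
      using y a by (intro wlen_le take_lists) simp
    finally show ?thesis by simp
  qed
  ultimately have "fellow_travel G A (4 * k + 2) (nf y @ [a]) []"
    using y a by (fastforce simp: fellow_travel_iff simp del: take_append intro: le_trans)
  then show ?thesis using one None by (intro bexI[of _ "[]"]) auto
next
  case (Some b)
  have ya: "y \<otimes> a \<in> carrier G" using y a by simp
  note b = nf_last_SomeD[OF Some ya]
  define u where "u = (nf y @ [a]) @ [inv b]"
  have u: "u \<in> lists A" "val u = y \<otimes> a \<otimes> inv b" "length u = wlen y + 2"
    using y a b length_nf[OF y] by (auto simp: u_def inv_A m_assoc)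
  have "wlen y \<le> wlen (y \<otimes> a) + 1" using wlen_letter_bounds y a by simp
  then have "length u \<le> wlen (val u) + 4" using u b by simp
  then obtain v where v: "v \<in> lists A" "length v = wlen (val u)" "val v = val u"
    "fellow_travel G A (4 * k) u v"
    using geodesic_fellow_traveler[OF u(1)] by blast
  have ly: "nf y @ [a] \<in> lists A" using y a by simp
  have "fellow_travel G A 1 (nf y @ [a]) u"
    unfolding u_def using b(1) by (intro fellow_travel_snoc ly inv_A)
  note near = fellow_travel_trans[OF ly u(1) v(1) this v(4)]
  \<comment> \<open>Appending \<open>inv b\<close> and later \<open>b\<close> costs one each; the
    four shortenings cost \<open>4 * k\<close>.\<close>
  have "fellow_travel G A (1 + 4 * k + 1) (nf y @ [a]) (v @ [b])"
    by (rule fellow_travel_trans[OF ly v(1) _ near fellow_travel_snoc[OF v(1) b(1)]])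
      (use v b in simp)
  then show ?thesis
    using v u b Some by (intro bexI[of _ "v @ [b]"]) (auto simp: add.commute)
qed

section \<open>The flow function\<close>

text \<open>Twice \<open>edge_height\<close>, to stay within the natural numbers.\<close>

definition height :: "'a \<Rightarrow> 'a \<Rightarrow> nat" where
  "height y a = wlen y + wlen (y \<otimes> a)"

text \<open>Neither \<open>nf y\<close> nor a fellow traveler is mentioned: relative lengths and
  chosen letters near \<open>y\<close> decide the condition, which makes a choice among such routes
  regular.\<close>

definition descending_route :: "nat \<Rightarrow> 'a \<Rightarrow> 'a \<Rightarrow> 'a list \<Rightarrow> bool" where
  "descending_route P y a p \<longleftrightarrow> p \<in> lists A \<and> length p \<le> P \<and> val p = a \<and>
     (\<forall>(z, c)\<in>set (edges y p). tree_edge z c \<or> height z c < height y a)"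

text \<open>
  The route follows \<open>nf y\<close> down for \<open>s\<close> steps, crosses to the fellow traveling word \<open>v\<close> and
  follows \<open>v\<close> up. The descent and the last edge of \<open>v\<close> lie in the tree.
\<close>

lemma descending_route_exists:
  assumes y: "y \<in> carrier G" and a: "a \<in> A"
  shows "\<exists>p. descending_route (12 * k + 11) y a p"
proof -
  define K where "K = 4 * k + 2"
  \<comment> \<open>Vertices of the crossing have length at most \<open>m + K\<close>, so starting
    it \<open>K + 2\<close> below \<open>y\<close> keeps its edges lower than the given one. Close
    to the identity, truncated subtraction gives \<open>m = 0\<close>.\<close>
  define s where "s = K + 2"
  define w where "w = nf y"
  obtain v where v: "v \<in> lists A" "val v = y \<otimes> a" "length v = wlen (y \<otimes> a)"
    "last_letter v = nf_last (y \<otimes> a)" and fellow: "fellow_travel G A K (w @ [a]) v"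
    using target_word[OF y a] by (auto simp: K_def w_def)
  have w: "w \<in> lists A" "nf_word w" "val w = y" "length w = wlen y"
    using nf_word_nf[OF y] length_nf[OF y] y by (auto simp: w_def)
  define m where "m = wlen y - s"
  define z0 where "z0 = val (take m w)"
  define z1 where "z1 = val (take m v)"
  have z: "z0 \<in> carrier G" "z1 \<in> carrier G" using w v by (auto simp: z0_def z1_def)
  have "m \<le> length w" using w by (simp add: m_def)
  then have "gap z0 z1 \<le> K"
    using fellow w v a by (auto simp: fellow_travel_iff z0_def z1_def dest: spec[of _ m])
  moreover obtain x where x: "x \<in> lists A" "length x = gap z0 z1" "val x = inv z0 \<otimes> z1"
    using obtain_geodesic[of "inv z0 \<otimes> z1"] z by auto
  ultimately have "length x \<le> K" by simp
  define p where "p = inv_word (drop m w) @ x @ drop m v"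
  have p: "p \<in> lists A" using w x v by (simp add: p_def)
  have down: "y \<otimes> val (inv_word (drop m w)) = z0"
    using val_take_drop[OF w(1), of m] w z by (auto simp: z0_def[symmetric] inv_solve_right')
  have cross: "z0 \<otimes> val x = z1" using x z by simp
  have up: "z1 \<otimes> val (drop m v) = y \<otimes> a"
    using val_take_drop[OF v(1), of m] v by (simp add: z1_def)
  have edges_p: "edges y p = edges y (inv_word (drop m w)) @ edges z0 x @ edges z1 (drop m v)"
    using y w x v z down cross by (simp add: p_def edges_append)
  have "y \<otimes> val p = y \<otimes> a"
    using y w x v z down cross up by (simp add: p_def m_assoc[symmetric])
  then have "val p = a" using y p a by simp
  \<comment> \<open>The descent takes at most \<open>s = 4 * k + 4\<close> letters, the crossing
    \<open>K = 4 * k + 2\<close> and the ascent \<open>s + 1\<close>.\<close>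
  moreover have "length p \<le> 12 * k + 11"
  proof -
    have "length v \<le> wlen y + 1" using wlen_letter_bounds(1)[OF y a] v by simp
    then show ?thesis
      using \<open>length x \<le> K\<close> w by (simp add: p_def m_def s_def K_def)
  qed
  moreover have "tree_edge z c \<or> height z c < height y a" if "(z, c) \<in> set (edges y p)" for z c
    using that unfolding edges_p set_append Un_iff
  proof (elim disjE)
    assume "(z, c) \<in> set (edges y (inv_word (drop m w)))"
    then show ?thesis using nf_word_descent[OF w(2)] w(3) by blast
  next
    assume "(z, c) \<in> set (edges z0 x)"
    then obtain i where i: "i < length x" "z = z0 \<otimes> val (take i x)" "c = x ! i"
      using z x by (auto simp: set_edges)
    \<comment> \<open>For \<open>m = 0\<close> both \<open>z0\<close> and \<open>z1\<close> are the
      identity and \<open>x\<close> is empty.\<close>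
    have "m > 0"
    proof (rule ccontr)
      assume "\<not> m > 0"
      then show False using i x by (simp add: z0_def z1_def)
    qed
    have "wlen z0 \<le> m" using wlen_le[of "take m w"] w by (simp add: z0_def)
    have near: "wlen (z0 \<otimes> val (take j x)) \<le> m + K" for j
      using wlen_mult[of z0 "val (take j x)"] wlen_le[of "take j x"] z x
        \<open>length x \<le> K\<close> \<open>wlen z0 \<le> m\<close> by simp
    have "z \<otimes> c = z0 \<otimes> val (take (Suc i) x)"
      using i x z by (simp add: take_Suc_conv_app_nth m_assoc)
    then have "height z c \<le> 2 * m + 2 * K"
      using near[of i] near[of "Suc i"] i by (simp add: height_def)
    moreover have "height y a \<ge> 2 * wlen y - 1"
      using wlen_letter_bounds(2)[OF y a] by (simp add: height_def)
    moreover have "wlen y = m + K + 2" using \<open>m > 0\<close> by (simp add: m_def s_def)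
    ultimately have "height z c < height y a" by linarith
    then show ?thesis ..
  next
    assume "(z, c) \<in> set (edges z1 (drop m v))"
    then have "(z, c) \<in> set (edges \<one> (take m v @ drop m v))"
      using v z by (simp add: edges_append z1_def del: append_take_drop_id)
    then obtain i where i: "i < length v" "z = val (take i v)" "c = v ! i"
      using v by (auto simp: set_edges)
    have zc: "z \<otimes> c = val (take (Suc i) v)"
      using i v by (simp add: take_Suc_conv_app_nth)
    \<comment> \<open>The last edge enters \<open>y \<otimes> a\<close> by its chosen letter; every
      earlier edge ends at a vertex of smaller length than \<open>y \<otimes> a\<close>.\<close>
    show ?thesis
    proof (cases "Suc i = length v")
      case True
      then have "last_letter v = Some c"
        using i diff_Suc_1[of i] by (auto simp: last_letter_def last_conv_nth)
      then show ?thesis using zc True v by (simp add: tree_edge_def)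
    next
      case False
      have "wlen z \<le> i" "wlen (z \<otimes> c) \<le> Suc i"
        using wlen_le[of "take i v"] wlen_le[of "take (Suc i) v"] i v zc by auto
      then show ?thesis
        using False i v wlen_letter_bounds(1)[OF y a] by (simp add: height_def)
    qed
  qed
  ultimately show ?thesis using p unfolding descending_route_def by blast
qed

section \<open>Locality of the choice of routes\<close>

lemma defect_cong_height:
  assumes "g \<in> carrier G" "h \<in> carrier G" "defect J g = defect J h"
    and "u \<in> lists A" "c \<in> A" "2 * Suc (length u) \<le> J"
  shows "height (g \<otimes> val u) c + 2 * wlen h = height (h \<otimes> val u) c + 2 * wlen g"
  using defect_cong_wlen[OF assms(1-4)] defect_cong_wlen[OF assms(1-3), of "u @ [c]"] assms
  by (simp add: height_def m_assoc)

lemma defect_cong_tree_edge: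
  assumes "g \<in> carrier G" "h \<in> carrier G" "defect J g = defect J h"
    and "u \<in> lists A" "c \<in> A" "2 * Suc (Suc (length u)) \<le> J"
  shows "tree_edge (g \<otimes> val u) c = tree_edge (h \<otimes> val u) c"
  using defect_cong_nf_last[OF assms(1-4)] defect_cong_nf_last[OF assms(1-3), of "u @ [c]"] assms
  by (simp add: tree_edge_def m_assoc)

text \<open>Passing from \<open>g\<close> to \<open>h\<close> shifts both sides of each height
  comparison by the same amount. The equality is one of predicates, so \<open>SOME\<close> selects
  the same route at both elements.\<close>

lemma defect_cong_descending_route:
  assumes g: "g \<in> carrier G" and h: "h \<in> carrier G" and eq: "defect J g = defect J h"
    and a: "a \<in> A" and J: "2 * Suc P \<le> J" "2 \<le> J"
  shows "descending_route P g a = descending_route P h a"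
proof
  fix p
  have "(tree_edge (g \<otimes> val (take i p)) (p ! i) \<or> height (g \<otimes> val (take i p)) (p ! i) < height g a)
      \<longleftrightarrow> (tree_edge (h \<otimes> val (take i p)) (p ! i) \<or> height (h \<otimes> val (take i p)) (p ! i) < height h a)"
    if "p \<in> lists A" "length p \<le> P" "i < length p" for i
  proof -
    have "height (g \<otimes> val (take i p)) (p ! i) + 2 * wlen h =
        height (h \<otimes> val (take i p)) (p ! i) + 2 * wlen g"
      using that J by (intro defect_cong_height[OF g h eq]) auto
    moreover have "height g a + 2 * wlen h = height h a + 2 * wlen g"
      using defect_cong_height[OF g h eq, of "[]" a] a g h J by simp
    moreover have "tree_edge (g \<otimes> val (take i p)) (p ! i) = tree_edge (h \<otimes> val (take i p)) (p ! i)"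
      using that J by (intro defect_cong_tree_edge[OF g h eq]) auto
    ultimately show ?thesis by linarith
  qed
  note same = this
  have edges: "(\<forall>(z, c)\<in>set (edges f p). Q z c) \<longleftrightarrow> (\<forall>i<length p. Q (f \<otimes> val (take i p)) (p ! i))"
    if "f \<in> carrier G" "p \<in> lists A" for f Q
    using set_edges[OF that] by auto
  show "descending_route P g a p \<longleftrightarrow> descending_route P h a p"
  proof (cases "p \<in> lists A \<and> length p \<le> P")
    case True
    then show ?thesis
      unfolding descending_route_def using edges[OF g] edges[OF h] same by simp
  qed (auto simp: descending_route_def)
qed

definition flow_label :: "nat \<Rightarrow> 'a \<Rightarrow> 'a \<Rightarrow> 'a list" where
  "flow_label P y a = (if tree_edge y a then [a] else (SOME p. descending_route P y a p))"

definition flow :: "'a \<times> 'a \<Rightarrow> ('a \<times> 'a) list" where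
  "flow e = edges (fst e) (flow_label (12 * k + 11) (fst e) (snd e))"

lemma flow_label_route:
  assumes "y \<in> carrier G" "a \<in> A" "\<not> tree_edge y a"
  shows "descending_route (12 * k + 11) y a (flow_label (12 * k + 11) y a)"
  using someI_ex[OF descending_route_exists[OF assms(1,2)]] assms(3) by (simp add: flow_label_def)

lemma flow_label_lists:
  assumes "y \<in> carrier G" "a \<in> A"
  shows "flow_label (12 * k + 11) y a \<in> lists A" "length (flow_label (12 * k + 11) y a) \<le> 12 * k + 11"
    "val (flow_label (12 * k + 11) y a) = a"
  using flow_label_route[OF assms] assms
  by (cases "tree_edge y a"; simp add: descending_route_def; simp add: flow_label_def)+

text \<open>A tree edge is its own flow path, so the edge \<open>(y, a)\<close> lies outside the
  tree and the route condition applies.\<close>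

lemma flow_descends:
  assumes "y \<in> carrier G" "a \<in> A" "(z, c) \<in> set (flow (y, a))" "\<not> tree_edge z c"
  shows "height z c < height y a"
proof -
  have "\<not> tree_edge y a"
    using assms(3,4) by (auto simp: flow_def flow_label_def)
  then show ?thesis
    using flow_label_route[OF assms(1,2)] assms(3,4) by (auto simp: descending_route_def flow_def)
qed

lemma edge_height_eq:
  assumes "y \<in> carrier G" "a \<in> A"
  shows "edge_height G A (y, a) = real (height y a) / 2"
  using assms by (simp add: edge_height_def cayley_graph_def cayley_dist_eq height_def)

lemma flow_tree_edge: "tree_edge y a \<Longrightarrow> flow (y, a) = [(y, a)]"
  by (simp add: flow_def flow_label_def)

lemma defect_cong_flow_label:
  assumes "g \<in> carrier G" "h \<in> carrier G" "defect J g = defect J h" "a \<in> A"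
    and J: "2 * Suc P \<le> J" "4 \<le> J"
  shows "flow_label P g a = flow_label P h a"
  using defect_cong_descending_route[OF assms(1-5)] J
    defect_cong_tree_edge[OF assms(1-3), of "[]" a] assms
  by (simp add: flow_label_def)

text \<open>The flow label depends only on the letter and on the defect reached by the normal form;
  the last two components are bounded and can be remembered.\<close>

lemma sync_regular_flow:
  "sync_regular [A, A, A] {[nf y, [a], path_label (flow (y, a))] | y a. y \<in> carrier G \<and> a \<in> A}"
proof -
  define P where "P = 12 * k + 11"
  define J where "J = 2 * Suc P"
  have J: "4 \<le> J" "2 * Suc P \<le> J" by (auto simp: J_def P_def)
  define L where "L = {[w, [a], flow_label P (val w) a] | w a. nf_word w \<and> a \<in> A}"
  have L_eq: "{[nf y, [a], path_label (flow (y, a))] | y a. y \<in> carrier G \<and> a \<in> A} = L"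
  proof (intro equalityI subsetI)
    fix t assume "t \<in> {[nf y, [a], path_label (flow (y, a))] | y a. y \<in> carrier G \<and> a \<in> A}"
    then obtain y a where "t = [nf y, [a], path_label (flow (y, a))]" "y \<in> carrier G" "a \<in> A"
      by blast
    then show "t \<in> L"
      unfolding L_def flow_def P_def using nf_word_nf by (auto intro!: exI[of _ "nf y"])
  next
    fix t assume "t \<in> L"
    then obtain w a where "t = [w, [a], flow_label P (val w) a]" "nf_word w" "a \<in> A"
      unfolding L_def by blast
    then show "t \<in> {[nf y, [a], path_label (flow (y, a))] | y a. y \<in> carrier G \<and> a \<in> A}"
      using nf_word_lists nf_equality
      by (auto simp: flow_def P_def intro!: exI[of _ "val w"])
  qed
  \<comment> \<open>Two letters suffice to recognise a one-letter word, and \<open>Suc P\<close>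
    letters to recognise a word of length at most \<open>P\<close>.\<close>
  define \<phi> where "\<phi> W = (nf_state J (track 0 W), take 2 (track 1 W), take (Suc P) (track 2 W))" for W
  have "finite_state (columns [A, A, A]) \<phi>"
    unfolding \<phi>_def using J
    by (intro finite_state_Pair finite_state_track)
      (auto simp: finite_state_nf_state finite_state_take finite_A)
  moreover have "L \<subseteq> listset (map lists [A, A, A])"
    using flow_label_lists(1) nf_word_lists unfolding L_def P_def
    by (auto simp: set_Cons_def)
  moreover have "[track 0 V, track 1 V, track 2 V] \<in> L"
    if UV: "\<phi> U = \<phi> V" and "[track 0 U, track 1 U, track 2 U] \<in> L" for U V
  proof -
    obtain w a where wa: "track 0 U = w" "track 1 U = [a]" "track 2 U = flow_label P (val w) a"
      "nf_word w" "a \<in> A"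
      using \<open>[track 0 U, track 1 U, track 2 U] \<in> L\<close> unfolding L_def by auto
    have eq: "nf_state J w = nf_state J (track 0 V)" "take 2 [a] = take 2 (track 1 V)"
      "take (Suc P) (flow_label P (val w) a) = take (Suc P) (track 2 V)"
      using UV wa by (auto simp: \<phi>_def)
    have nf: "nf_word (track 0 V)" "defect J (val w) = defect J (val (track 0 V))"
      using eq(1) wa(4) by (auto simp: nf_state_def split: if_splits)
    have "track 1 V = [a]" using take_eq_shortD[OF _ eq(2)] by simp
    moreover have "track 2 V = flow_label P (val w) a"
      using take_eq_shortD[OF _ eq(3)] flow_label_lists(2)[of "val w" a] wa nf_word_lists
      by (simp add: P_def)
    moreover have "flow_label P (val w) a = flow_label P (val (track 0 V)) a"
      using wa nf nf_word_lists J by (intro defect_cong_flow_label[of _ _ J]) auto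
    ultimately show ?thesis unfolding L_def using nf wa by auto
  qed
  moreover have "map (\<lambda>i. track i W) [0..<length [A, A, A]] = [track 0 W, track 1 W, track 2 W]"
    for W :: "'a option list list"
    by (simp add: upt_conv_Cons numeral_2_eq_2)
  ultimately show ?thesis
    unfolding L_eq using finite_A by (intro sync_regularI[of _ _ \<phi>]) (simp, assumption, assumption, metis)
qed

lemma geodesically_autostackable: "geodesically_autostackable G A"
proof -
  have arcs: "arcs (cayley_graph G A) = carrier G \<times> A"
    and ends: "tail (cayley_graph G A) (y, a) = y" "head (cayley_graph G A) (y, a) = y \<otimes> a" for y a
    by (auto simp: cayley_graph_def)
  have tree: "(y, a) \<in> arcs nf_tree \<longleftrightarrow> y \<in> carrier G \<and> a \<in> A \<and> tree_edge y a" for y a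
    by (auto simp: nf_tree_def)
  have "\<nexists>s :: nat \<Rightarrow> 'a \<times> 'a.
      \<forall>i. s i \<in> carrier G \<times> A - arcs nf_tree \<and> s (Suc i) \<in> set (flow (s i))"
  proof
    assume "\<exists>s :: nat \<Rightarrow> 'a \<times> 'a.
      \<forall>i. s i \<in> carrier G \<times> A - arcs nf_tree \<and> s (Suc i) \<in> set (flow (s i))"
    then obtain s :: "nat \<Rightarrow> 'a \<times> 'a" where
      s: "\<And>i. s i \<in> carrier G \<times> A - arcs nf_tree" "\<And>i. s (Suc i) \<in> set (flow (s i))" by blast
    have "(s (Suc i), s i) \<in> measure (\<lambda>(y, a). height y a)" for i
    proof -
      obtain y a z c where e: "s i = (y, a)" "s (Suc i) = (z, c)" by (meson surj_pair)
      then have "height z c < height y a"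
        using s(1)[of i] s(1)[of "Suc i"] s(2)[of i] by (intro flow_descends) (auto simp: tree)
      then show ?thesis using e by simp
    qed
    then show False
      using wf_measure wf_iff_no_infinite_down_chain by blast
  qed
  moreover have "cayley_path G A y (flow (y, a)) (y \<otimes> a)" if "y \<in> carrier G" "a \<in> A" for y a
    unfolding cayley_path_iff flow_def
    using that flow_label_lists[OF that] by (auto intro!: bexI[of _ "flow_label (12 * k + 11) y a"])
  moreover have "length (flow (y, a)) \<le> 12 * k + 11" if "y \<in> carrier G" "a \<in> A" for y a
    using flow_label_lists[OF that] by (simp add: flow_def)
  moreover have "{[tree_nf G nf_tree (tail (cayley_graph G A) e), [snd e], path_label (flow e)] | e.
      e \<in> carrier G \<times> A} = {[nf y, [a], path_label (flow (y, a))] | y a. y \<in> carrier G \<and> a \<in> A}"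
    by (auto simp: ends tree_nf_eq) (metis ends(1) mem_Sigma_iff snd_conv tree_nf_eq)
  ultimately have "regular_bounded_flow G A nf_tree flow"
    unfolding regular_bounded_flow_def Let_def arcs
    using sync_regular_flow by (auto simp: ends tree flow_tree_edge intro!: exI[of _ "12 * k + 11"])
  moreover have "geodesic_word G A (tree_nf G nf_tree g)" if "g \<in> carrier G" for g
    using that length_nf by (simp add: tree_nf_eq geodesic_word_iff)
  moreover have "edge_height G A e' < edge_height G A e"
    if "e \<in> carrier G \<times> A" "e' \<in> carrier G \<times> A" "flow e' \<noteq> [e']" "e' \<in> set (flow e)" for e e'
  proof -
    obtain y a z c where e: "e = (y, a)" "e' = (z, c)" by (meson surj_pair)
    then have "height z c < height y a"
      using that flow_tree_edge by (intro flow_descends) auto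
    then show ?thesis using that e by (simp add: edge_height_eq)
  qed
  ultimately show ?thesis
    unfolding geodesically_autostackable_def arcs using cayley_spanning_tree_nf_tree by blast
qed

end


section \<open>The prefix-rewriting system\<close>

context marked_group
begin

section \<open>Comparing the two sides of a rule\<close>

definition divergence :: "'a option list list \<Rightarrow> 'a" where
  "divergence W = inv (val (track 0 W)) \<otimes> val (track 1 W)"

text \<open>\<open>None\<close> records for good that some prefix has exceeded the bound; otherwise
  the memory is an element of a finite ball.\<close>

definition bounded_divergence :: "nat \<Rightarrow> 'a option list list \<Rightarrow> 'a option" where
  "bounded_divergence K W =
     (if \<forall>t. wlen (divergence (take t W)) \<le> K then Some (divergence W) else None)"

lemma divergence_closed:
  assumes "W \<in> lists (columns [A, A])"
  shows "divergence W \<in> carrier G" "track 0 W \<in> lists A" "track 1 W \<in> lists A"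
  using track_in_lists[OF assms, of 0] track_in_lists[OF assms, of 1]
  by (auto simp: divergence_def simp del: listset.simps)

text \<open>A column multiplies by one letter on each side, padding counting as the identity, so no
  memory beyond the divergence is needed.\<close>

lemma divergence_snoc:
  assumes "W \<in> lists (columns [A, A])" "c \<in> columns [A, A]"
  defines "letter \<equiv> \<lambda>x. case x of None \<Rightarrow> \<one> | Some a \<Rightarrow> a"
  shows "divergence (W @ [c]) = inv (letter (c ! 0)) \<otimes> divergence W \<otimes> letter (c ! 1)"
proof -
  have c: "c ! i \<in> insert None (Some ` A)" if "i < 2" for i
    using assms(2) that unfolding listset_iff by (auto simp: less_Suc_eq numeral_2_eq_2)
  have snoc: "val (track i (W @ [c])) = val (track i W) \<otimes> letter (c ! i)" "letter (c ! i) \<in> carrier G"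
    if "i < 2" for i
    using c[OF that] track_in_lists[OF assms(1), of i] that
    by (auto simp: letter_def less_Suc_eq numeral_2_eq_2 simp del: listset.simps)
  show ?thesis
    unfolding divergence_def using snoc[of 0] snoc[of 1] divergence_closed[OF assms(1)]
    by (simp add: inv_mult_group m_assoc)
qed

lemma finite_state_bounded_divergence: "finite_state (columns [A, A]) (bounded_divergence K)"
proof (rule finite_stateI)
  note finite_ball[of K]
  moreover have "bounded_divergence K ` lists (columns [A, A]) \<subseteq>
      insert None (Some ` ball K)"
  proof (rule image_subsetI)
    fix W assume W: "W \<in> lists (columns [A, A])"
    show "bounded_divergence K W \<in> insert None (Some ` ball K)"
    proof (cases "\<forall>t. wlen (divergence (take t W)) \<le> K")
      case True
      then have "wlen (divergence W) \<le> K" by (metis take_all_iff order_refl)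
      then show ?thesis using divergence_closed(1)[OF W] by (simp add: bounded_divergence_def ball_def)
    next
      case False
      then show ?thesis unfolding bounded_divergence_def if_not_P[OF False] by simp
    qed
  qed
  ultimately show "finite (bounded_divergence K ` lists (columns [A, A]))"
    using finite_subset by blast
  fix U V c
  assume *: "U \<in> lists (columns [A, A])" "V \<in> lists (columns [A, A])" "c \<in> columns [A, A]"
    "bounded_divergence K U = bounded_divergence K V"
  have all: "(\<forall>t. wlen (divergence (take t (W @ [c]))) \<le> K) \<longleftrightarrow>
      (\<forall>t. wlen (divergence (take t W)) \<le> K) \<and> wlen (divergence (W @ [c])) \<le> K" for W
    by (rule all_take_snoc)
  show "bounded_divergence K (U @ [c]) = bounded_divergence K (V @ [c])"
  proof (cases "\<forall>t. wlen (divergence (take t U)) \<le> K")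
    case True
    then have "\<forall>t. wlen (divergence (take t V)) \<le> K" "divergence U = divergence V"
      using *(4) by (auto simp: bounded_divergence_def split: if_splits)
    then show ?thesis
      using True divergence_snoc[OF *(1,3)] divergence_snoc[OF *(2,3)]
      unfolding bounded_divergence_def all by simp
  next
    case False
    then have "\<not> (\<forall>t. wlen (divergence (take t V)) \<le> K)"
      using *(4) by (auto simp: bounded_divergence_def split: if_splits)
    then show ?thesis using False unfolding bounded_divergence_def all by simp
  qed
qed

text \<open>The first \<open>t\<close> columns contain the first \<open>t\<close> letters of either
  track, also beyond the end of the shorter one, in accordance with fellow traveling.\<close>

lemma bounded_divergence_iff:
  assumes "W \<in> lists (columns [A, A])" "well_padded 2 W"
  shows "fellow_travel G A K (track 0 W) (track 1 W) \<and> val (track 0 W) = val (track 1 W) \<longleftrightarrow>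
    bounded_divergence K W = Some \<one>"
proof -
  have "divergence (take t W) = inv (val (take t (track 0 W))) \<otimes> val (take t (track 1 W))" for t
    using assms(2) by (simp add: divergence_def track_take)
  then have "fellow_travel G A K (track 0 W) (track 1 W) \<longleftrightarrow>
      (\<forall>t. wlen (divergence (take t W)) \<le> K)"
    using divergence_closed[OF assms(1)] by (simp add: fellow_travel_iff)
  moreover have "val (track 0 W) = val (track 1 W) \<longleftrightarrow> divergence W = \<one>"
    using divergence_closed[OF assms(1)] inv_solve_left'[of \<one> "val (track 0 W)" "val (track 1 W)"]
    by (auto simp: divergence_def)
  ultimately show ?thesis by (simp add: bounded_divergence_def)
qed

lemma nf_word_split:
  assumes "w \<in> lists A" "\<not> nf_word w"
  shows "\<exists>u l z. w = u @ l # z \<and> nf_word u \<and> \<not> nf_word (u @ [l])"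
  using assms
proof (induction w rule: rev_induct)
  case (snoc a w)
  show ?case
  proof (cases "nf_word w")
    case False
    then obtain u l z where "w = u @ l # z" "nf_word u" "\<not> nf_word (u @ [l])"
      using snoc by auto
    then show ?thesis by (intro exI[of _ u] exI[of _ l] exI[of _ "z @ [a]"]) simp
  qed (use snoc.prems in blast)
qed simp

section \<open>A binary measure for termination\<close>

definition misfit :: "'a list \<Rightarrow> nat" where
  "misfit w = (\<Sum>i<length w. if nf_last (val (take (Suc i) w)) = Some (w ! i) then 0 else 2 ^ i)"

lemma misfit_Nil [simp]: "misfit [] = 0"
  and misfit_snoc: "misfit (w @ [a]) =
    misfit w + (if nf_last (val (w @ [a])) = Some a then 0 else 2 ^ length w)"
  by (simp_all add: misfit_def nth_append del: val_append)

lemma misfit_less: "misfit w < 2 ^ length w"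
  by (induction w rule: rev_induct) (auto simp: misfit_snoc simp del: val_append)

lemma misfit_nf_word: "nf_word w \<Longrightarrow> misfit w = 0"
  by (induction w rule: rev_induct) (auto simp: misfit_snoc nf_word_snoc simp del: val_append)

text \<open>Beyond \<open>u\<close> and \<open>v\<close> all prefix values and positions agree, so
  \<open>z\<close> contributes equally. The additive form avoids truncated subtraction.\<close>

lemma misfit_append:
  assumes "u \<in> lists A" "v \<in> lists A" "val u = val v" "length u = length v" "z \<in> lists A"
  shows "misfit (u @ z) + misfit v = misfit (v @ z) + misfit u"
  using assms(5)
proof (induction z rule: rev_induct)
  case (snoc a z)
  then have "val ((u @ z) @ [a]) = val ((v @ z) @ [a])"
    using assms by simp
  then show ?case
    using snoc assms(4) misfit_snoc[of "u @ z" a] misfit_snoc[of "v @ z" a]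
    by (simp del: val_append)
qed simp

definition last_letter_rules :: "nat \<Rightarrow> ('a list \<times> 'a list) set" where
  "last_letter_rules K = {(w @ [l], v) | w l v. nf_word w \<and> l \<in> A \<and> v \<in> lists A \<and>
     \<not> nf_word (w @ [l]) \<and> length v \<le> Suc (length w) \<and> val v = val w \<otimes> l \<and>
     last_letter v = nf_last (val w \<otimes> l) \<and> fellow_travel G A K (w @ [l]) v}"

lemma last_letter_rulesD:
  assumes "(u, v) \<in> last_letter_rules K"
  shows "u \<in> lists A" "v \<in> lists A" "val u = val v" "length v \<le> length u" "\<not> nf_word u"
    "last_letter v = nf_last (val v)"
  using assms nf_word_lists by (auto simp: last_letter_rules_def)

lemma prefix_rewriteD:
  assumes "(x, y) \<in> prefix_rewrite A (last_letter_rules K)"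
  shows "x \<in> lists A" "y \<in> lists A" "val x = val y"
    "(y, x) \<in> measures [length, misfit]"
proof -
  obtain u v z where uvz: "x = u @ z" "y = v @ z" "(u, v) \<in> last_letter_rules K" "z \<in> lists A"
    using assms by (auto simp: prefix_rewrite_def)
  note uv = last_letter_rulesD[OF uvz(3)]
  show "x \<in> lists A" "y \<in> lists A" "val x = val y" using uv uvz by auto
  \<comment> \<open>Only the last letter of \<open>u\<close> is wrong; its weight exceeds the whole
    misfit of \<open>v\<close>, whose last letter is right. The common suffix cancels.\<close>
  have "misfit y < misfit x" if len: "length v = length u"
  proof -
    obtain w l where u: "u = w @ [l]" "nf_word w"
      using uvz(3) by (auto simp: last_letter_rules_def)
    then have "nf_last (val u) \<noteq> Some l" using uv(1,5) by (auto simp: nf_word_snoc)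
    then have "misfit u = 2 ^ length w"
      using u by (simp add: misfit_snoc misfit_nf_word del: val_append)
    moreover obtain v' b where v: "v = v' @ [b]"
      using len u by (cases v rule: rev_cases) auto
    then have "misfit v = misfit v'"
      using uv(6) by (simp add: misfit_snoc del: val_append)
    then have "misfit v < 2 ^ length w"
      using misfit_less[of v'] v u len by simp
    ultimately show ?thesis
      using misfit_append[OF uv(1-3) len[symmetric] uvz(4)] uvz by simp
  qed
  then show "(y, x) \<in> measures [length, misfit]" using uv(4) uvz by auto
qed

end

context fftp_group
begin

section \<open>Convergence, end-normality and regularity of the rules\<close>

definition rules :: "('a list \<times> 'a list) set" where
  "rules = last_letter_rules (4 * k + 2)"

text \<open>The shortest prefix that is not a normal form is a left side, and
  \<open>target_word\<close> supplies the right side together with the constant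
  \<open>4 * k + 2\<close>.\<close>

lemma rules_step:
  assumes "w \<in> lists A" "\<not> nf_word w"
  shows "\<exists>w'. (w, w') \<in> prefix_rewrite A rules"
proof -
  obtain u l z where w: "w = u @ l # z" "nf_word u" "\<not> nf_word (u @ [l])"
    using nf_word_split[OF assms] by blast
  then have l: "u \<in> lists A" "l \<in> A" "z \<in> lists A" using assms(1) by auto
  then obtain v where v: "v \<in> lists A" "val v = val u \<otimes> l" "length v = wlen (val u \<otimes> l)"
      "last_letter v = nf_last (val u \<otimes> l)" "fellow_travel G A (4 * k + 2) (u @ [l]) v"
    using target_word[of "val u" l] nf_equality[OF w(2)] by auto
  have "length v \<le> Suc (length u)"
    using v wlen_letter_bounds(1)[of "val u" l] nf_word_length[OF w(2)] l by simp
  then have "(u @ [l], v) \<in> rules"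
    unfolding rules_def last_letter_rules_def using w v l by blast
  then have "((u @ [l]) @ z, v @ z) \<in> prefix_rewrite A rules"
    unfolding prefix_rewrite_def using l by blast
  then show ?thesis using w by auto
qed

text \<open>Normal forms are closed under prefixes, so none of them begins with a left side.\<close>

lemma irreducible_rules_iff: "irreducible_word A rules w \<longleftrightarrow> nf_word w"
proof
  assume "irreducible_word A rules w"
  then show "nf_word w" using rules_step unfolding irreducible_word_def by blast
next
  assume nf: "nf_word w"
  have "(w, w') \<notin> prefix_rewrite A rules" for w'
  proof
    assume "(w, w') \<in> prefix_rewrite A rules"
    then obtain u v z where "w = u @ z" "(u, v) \<in> rules"
      by (auto simp: prefix_rewrite_def)
    then show False
      using nf_word_take[OF nf, of "length u"] last_letter_rulesD(5) by (auto simp: rules_def)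
  qed
  then show "irreducible_word A rules w"
    using nf nf_word_lists by (auto simp: irreducible_word_def)
qed

text \<open>A prefix rewriting is a relation step with empty left context, and it decreases the
  termination order.\<close>

lemma reduces_to_nf: "w \<in> lists A \<Longrightarrow> (w, nf (val w)) \<in> (relation_step A rules)\<^sup>*"
proof (induction w rule: wf_induct_rule[OF wf_measures[of "[length, misfit]"]])
  case (1 w)
  show ?case
  proof (cases "nf_word w")
    case True
    then show ?thesis by (simp add: nf_equality)
  next
    case False
    then obtain w' where w': "(w, w') \<in> prefix_rewrite A rules" using rules_step 1 by blast
    note step = prefix_rewriteD[OF w'[unfolded rules_def]]
    obtain u v z where "w = [] @ u @ z" "w' = [] @ v @ z" "(u, v) \<in> rules" "z \<in> lists A"
      using w' by (auto simp: prefix_rewrite_def)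
    then have "(w, w') \<in> relation_step A rules"
      unfolding relation_step_def using lists.Nil by blast
    moreover have "(w', nf (val w)) \<in> (relation_step A rules)\<^sup>*"
      using "1.IH"[OF step(4,2)] step(3) by simp
    ultimately show ?thesis by (rule converse_rtrancl_into_rtrancl)
  qed
qed

lemma relation_step_val:
  assumes "(u, v) \<in> (relation_step A rules \<union> (relation_step A rules)\<inverse>)\<^sup>*"
  shows "val u = val v"
  using assms
proof (induction rule: rtrancl_induct)
  case (step y z)
  have "val s = val t" if "(s, t) \<in> relation_step A rules" for s t
    using that last_letter_rulesD(1-3) by (auto simp: relation_step_def rules_def)
  then show ?case using step by auto
qed simp

lemma convergent_rules: "convergent_prs G A rules"
  unfolding convergent_prs_def
proof (intro conjI)
  show "rules \<subseteq> lists A \<times> lists A"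
    using last_letter_rulesD(1,2) by (auto simp: rules_def)
  show "monoid_presents G A rules"
    unfolding monoid_presents_def
  proof (intro conjI ballI iffI)
    show "val ` lists A = carrier G" using val_surj val_closed by blast
    fix u v assume uv: "u \<in> lists A" "v \<in> lists A" "val u = val v"
    let ?S = "relation_step A rules"
    have "(u, nf (val u)) \<in> (?S \<union> ?S\<inverse>)\<^sup>*"
      using reduces_to_nf[OF uv(1)] rtrancl_mono[of ?S "?S \<union> ?S\<inverse>"] by blast
    moreover have "(nf (val u), v) \<in> (?S \<union> ?S\<inverse>)\<^sup>*"
      using reduces_to_nf[OF uv(2)] rtrancl_mono[of "?S\<inverse>" "?S \<union> ?S\<inverse>"] uv(3)
      by (auto simp: rtrancl_converse)
    ultimately show "(u, v) \<in> (?S \<union> ?S\<inverse>)\<^sup>*" by (rule rtrancl_trans)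
  qed (rule relation_step_val)
  show "\<nexists>s :: nat \<Rightarrow> 'a list. \<forall>i. (s i, s (Suc i)) \<in> prefix_rewrite A rules"
  proof
    assume "\<exists>s :: nat \<Rightarrow> 'a list. \<forall>i. (s i, s (Suc i)) \<in> prefix_rewrite A rules"
    then obtain s :: "nat \<Rightarrow> 'a list" where "\<And>i. (s i, s (Suc i)) \<in> prefix_rewrite A rules" by blast
    then have "(s (Suc i), s i) \<in> measures [length, misfit]" for i
      using prefix_rewriteD(4) unfolding rules_def by blast
    then show False
      using wf_measures wf_iff_no_infinite_down_chain by blast
  qed
  show "\<forall>g\<in>carrier G. \<exists>!w. irreducible_word A rules w \<and> val w = g"
    unfolding irreducible_rules_iff using nf_word_exists nf_word_unique by metis
qed

lemma prs_nf_rules: "prs_nf G A rules u = nf (val u)"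
  unfolding prs_nf_def irreducible_rules_iff nf_def ..

text \<open>Both last letters are the letter chosen for the value of \<open>v\<close>.\<close>

lemma end_normal_rules: "end_normal G A rules"
  unfolding end_normal_def prs_nf_rules
proof (intro allI impI, elim conjE)
  fix w l v assume "(w @ [l], v) \<in> rules"
  then have "last_letter v = last_letter (nf (val v))"
    using last_letter_rulesD[of "w @ [l]" v "4 * k + 2"] last_letter_nf_word[OF nf_word_nf, of "val v"]
    by (simp add: rules_def)
  then show "(v = [] \<longleftrightarrow> nf (val v) = []) \<and> (v \<noteq> [] \<longrightarrow> last v = last (nf (val v)))"
    unfolding last_letter_eq_iff .
qed

lemma length_nonincreasing_rules: "length_nonincreasing rules"
  unfolding length_nonincreasing_def rules_def using last_letter_rulesD(4) by blast

text \<open>The witnesses \<open>w\<close> and \<open>l\<close> become \<open>butlast u\<close> and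
  \<open>last u\<close>, so that each conjunct can be read off a map with finitely many
  states.\<close>

lemma rules_iff:
  "(u, v) \<in> rules \<longleftrightarrow> u \<in> lists A \<and> v \<in> lists A \<and> u \<noteq> [] \<and> nf_word (butlast u) \<and> \<not> nf_word u \<and>
    length v \<le> length u \<and> last_letter v = nf_last (val (butlast u) \<otimes> last u) \<and>
    fellow_travel G A (4 * k + 2) u v \<and> val u = val v"
proof (cases u rule: rev_cases)
  case (snoc w l)
  then show ?thesis
    using nf_word_lists[of w] by (auto simp: rules_def last_letter_rules_def)
qed (auto simp: rules_def last_letter_rules_def)

lemma sync_regular_rules: "sync_regular_prs A rules"
  unfolding sync_regular_prs_def
proof -
  define K where "K = 4 * k + 2"
  \<comment> \<open>The defect before the last letter decides which letter is chosen after it;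
    looking one letter ahead takes the cap four.\<close>
  define prev where "prev u = (nf_state 4 u,
    if u = [] then None else Some (nf_state 4 (butlast u), last u))" for u
  \<comment> \<open>The divergence tests fellow traveling and equality of values; the last component
    is the length condition, by \<open>well_padded_length_iff\<close>.\<close>
  define \<phi> where "\<phi> W = (prev (track 0 W), last_letter (track 1 W), bounded_divergence K W,
    \<forall>c\<in>set W. c ! 0 \<noteq> None)" for W
  have "finite_state A prev"
    unfolding prev_def by (intro finite_state_prev finite_A finite_state_nf_state) simp
  then have \<phi>: "finite_state (columns [A, A]) \<phi>"
    unfolding \<phi>_def
    by (intro finite_state_Pair finite_state_track finite_state_bounded_divergence
        finite_state_all_letters) (auto simp: finite_state_last_letter finite_A)
  have tracks: "map (\<lambda>i. track i W) [0..<length [A, A]] = [track 0 W, track 1 W]"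
    for W :: "'a option list list"
    by (simp add: upt_conv_Cons)
  have "(track 0 V, track 1 V) \<in> rules"
    if UV: "U \<in> lists (columns [A, A])" "V \<in> lists (columns [A, A])" "well_padded 2 U"
      "well_padded 2 V" "\<phi> U = \<phi> V" and rule: "(track 0 U, track 1 U) \<in> rules" for U V
  proof -
    note U = rule[unfolded rules_iff]
    note lists = divergence_closed(2,3)[OF UV(1)] divergence_closed(2,3)[OF UV(2)]
    have prev: "prev (track 0 U) = prev (track 0 V)" using UV(5) by (simp add: \<phi>_def)
    then have ne: "track 0 V \<noteq> []" "last (track 0 V) = last (track 0 U)"
      and st: "nf_state 4 (track 0 U) = nf_state 4 (track 0 V)"
        "nf_state 4 (butlast (track 0 U)) = nf_state 4 (butlast (track 0 V))"
      using U by (auto simp: prev_def split: if_splits)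
    have nf: "\<not> nf_word (track 0 V)" "nf_word (butlast (track 0 V))"
      and eq: "defect 4 (val (butlast (track 0 U))) = defect 4 (val (butlast (track 0 V)))"
      using st U by (auto simp: nf_state_def split: if_splits)
    have "last (track 0 U) \<in> A" using U lists(1) by (metis append_butlast_last_id append_in_lists_conv Cons_in_lists_iff)
    then have "nf_last (val (butlast (track 0 U)) \<otimes> last (track 0 U)) =
        nf_last (val (butlast (track 0 V)) \<otimes> last (track 0 V))"
      using defect_cong_nf_last[OF _ _ eq, of "[last (track 0 U)]"] ne U nf nf_word_lists by simp
    moreover have "last_letter (track 1 U) = last_letter (track 1 V)"
      using UV(5) by (simp add: \<phi>_def)
    moreover have "length (track 1 V) \<le> length (track 0 V)"
      using U UV(5) well_padded_length_iff[OF UV(3)] well_padded_length_iff[OF UV(4)]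
      by (simp add: \<phi>_def)
    moreover have "fellow_travel G A K (track 0 V) (track 1 V) \<and> val (track 0 V) = val (track 1 V)"
      using U UV(5) bounded_divergence_iff[OF UV(1,3), of K] bounded_divergence_iff[OF UV(2,4), of K]
      by (simp add: \<phi>_def K_def)
    ultimately show ?thesis
      unfolding rules_iff using ne nf lists U by (simp add: K_def)
  qed
  note det = this
  have incl: "{[u, v] | u v. (u, v) \<in> rules} \<subseteq> listset (map lists [A, A])"
    by (auto simp: set_Cons_def rules_iff)
  show "sync_regular [A, A] {[u, v] | u v. (u, v) \<in> rules}"
  proof (rule sync_regularI[OF _ incl \<phi>])
    show "\<forall>B\<in>set [A, A]. finite B" using finite_A by simp
    have two: "length [A, A] = 2" by simp
    fix U V
    assume "U \<in> lists (columns [A, A])" "V \<in> lists (columns [A, A])"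
      "well_padded (length [A, A]) U" "well_padded (length [A, A]) V" "\<phi> U = \<phi> V"
      "map (\<lambda>i. track i U) [0..<length [A, A]] \<in> {[u, v] | u v. (u, v) \<in> rules}"
    then have "(track 0 V, track 1 V) \<in> rules"
      unfolding tracks unfolding two by (intro det[of U V]) blast+
    then show "map (\<lambda>i. track i V) [0..<length [A, A]] \<in> {[u, v] | u v. (u, v) \<in> rules}"
      unfolding tracks by blast
  qed
qed

end

theorem theoremD:
  fixes G :: "('a, 'm) monoid_scheme" and A :: "'a set"
  assumes "group G"
    and "finite A" and "A \<subseteq> carrier G" and "generate G A = carrier G"
    and "\<forall>a\<in>A. inv\<^bsub>G\<^esub> a \<in> A"
    and "FFTP G A"
  shows "(\<exists>R. convergent_prs G A R \<and> length_nonincreasing R \<and> end_normal G A R \<and>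
              sync_regular_prs A R) \<and>
         geodesically_autostackable G A"
proof -
  interpret marked_group G A
    using assms(1-5) by (simp add: marked_group_def marked_group_axioms_def)
  obtain k where k: "\<forall>u\<in>lists A. \<not> geodesic_word G A u \<longrightarrow>
      (\<exists>v\<in>lists A. length v < length u \<and> val u = val v \<and> fellow_travel G A k u v)"
    using assms(6) unfolding FFTP_def by blast
  interpret fftp_group G A k
  proof unfold_locales
    fix u assume u: "u \<in> lists A" "wlen (val u) < length u"
    then have "\<not> geodesic_word G A u" by (simp add: geodesic_word_iff)
    then show "\<exists>v\<in>lists A. length v < length u \<and> val v = val u \<and> fellow_travel G A k u v"
      using k u(1) by metis
  qed
  show ?thesis
    using convergent_rules length_nonincreasing_rules end_normal_rules sync_regular_rules
      geodesically_autostackable by blast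
qed

end
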